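(* Let $n\geq 2$ and let $H_{2n+1}$ be the helm graph on the vertex set $\{1,\ldots,4n+3\}$. Then the cover ideal $J(H_{2n+1})$ is normal. Therefore, it has the strong persistence property, and hence the persistence property.
   Context: The wheel graph $W_m$ of order $m$ is the graph consisting of a cycle on $m-1$ vertices together with one further vertex (the hub) that is joined to every vertex of the cycle. The helm graph $H_m$, which has $2m+1$ vertices, is obtained from the wheel graph $W_{m+1}$ by adjoining a pendant edge (to a new vertex) at each vertex of the outer cycle of $W_{m+1}$. Explicitly, $H_{2n+1}$ has vertex set $\{1,\ldots,4n+3\}$, with $1,\ldots,2n+1$ forming a cycle of length $2n+1$ (in this cyclic order), vertex $2n+2$ adjacent to each of $1,\ldots,2n+1$, and the additional edges $\{i,2n+2+i\}$ for $i=1,\ldots,2n+1$. Let $K$ be a field. For a finite simple graph $G$, a vertex cover of $G$ is a subset $W\subseteq V(G)$ that intersects every edge of $G$; it is minimal if no proper subset of it is a vertex cover. If $W_1,\ldots,W_r$ are the minimal vertex covers of $G$, the cover ideal of $G$ is the ideal $J(G)=(X_{W_1},\ldots,X_{W_r})$ of the polynomial ring $K[x_u : u\in V(G)]$, where $X_{W_j}=\prod_{u\in W_j}x_u$. For an ideal $I$ of a commutative ring $R$, an element $f\in R$ is integral over $I$ if there is an equation $f^k+c_1f^{k-1}+\cdots+c_{k-1}f+c_k=0$ with $c_i\in I^i$. The set $\overline{I}$ of elements integral over $I$ is the integral closure of $I$; $I$ is integrally closed if $I=\overline{I}$, and $I$ is normal if all powers $I^t$, $t\ge 1$, are integrally closed.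 An ideal $I$ in a commutative Noetherian ring $S$ has the persistence property if $\mathrm{Ass}_S(S/I^k)\subseteq \mathrm{Ass}_S(S/I^{k+1})$ for all positive integers $k$, and has the strong persistence property if $(I^{k+1}:_S I)=I^k$ for all positive integers $k$. *)

theory Defs
  imports
    "HOL-Algebra.QuotRing"
    "HOL-Algebra.Ideal_Product"
    "HOL-Library.Poly_Mapping"
begin

section \<open>Polynomial rings\<close>

type_synonym ('v, 'k) mpoly = "('v \<Rightarrow>\<^sub>0 nat) \<Rightarrow>\<^sub>0 'k"

text \<open>
  The ring \<open>K[x\<^sub>v : v \<in> V]\<close>. The type \<^typ>\<open>('v, 'k) mpoly\<close> has a variable for every element
  of \<^typ>\<open>'v\<close>, so the carrier is restricted to the polynomials all of whose monomials involve
  only variables from \<open>V\<close>.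
\<close>

definition mpoly_ring :: "'v set \<Rightarrow> ('v, 'k::field) mpoly ring" where
  "mpoly_ring V =
    \<lparr>carrier = {p. \<forall>m\<in>Poly_Mapping.keys p. Poly_Mapping.keys m \<subseteq> V}, mult = (*), one = 1, zero = 0, add = (+)\<rparr>"

definition mvar :: "'v \<Rightarrow> ('v, 'k::field) mpoly" where
  "mvar v = Poly_Mapping.single (Poly_Mapping.single v 1) 1"

lemma cring_mpoly_ring: "cring (mpoly_ring V :: ('v, 'k::field) mpoly ring)"
proof (rule cringI)
  let ?R = "mpoly_ring V :: ('v, 'k) mpoly ring"
  show "abelian_group ?R"
  proof (rule abelian_groupI)
    fix x y assume "x \<in> carrier ?R" "y \<in> carrier ?R"
    then show "x \<oplus>\<^bsub>?R\<^esub> y \<in> carrier ?R"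
      using keys_add[of x y] by (auto simp: mpoly_ring_def dest!: subsetD)
  next
    fix x assume "x \<in> carrier ?R"
    then show "\<exists>y\<in>carrier ?R. y \<oplus>\<^bsub>?R\<^esub> x = \<zero>\<^bsub>?R\<^esub>"
      by (intro bexI[of _ "- x"]) (auto simp: mpoly_ring_def)
  qed (auto simp: mpoly_ring_def add_ac)
  show "Group.comm_monoid ?R"
  proof (rule comm_monoidI)
    fix x y assume xy: "x \<in> carrier ?R" "y \<in> carrier ?R"
    have "Poly_Mapping.keys m \<subseteq> V" if m: "m \<in> Poly_Mapping.keys (x * y)" for m
    proof -
      obtain a b where "m = a + b" "a \<in> Poly_Mapping.keys x" "b \<in> Poly_Mapping.keys y"
        using keys_mult[of x y] m by blast
      then show ?thesis
        using xy keys_add[of a b] by (fastforce simp: mpoly_ring_def)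
    qed
    then show "x \<otimes>\<^bsub>?R\<^esub> y \<in> carrier ?R"
      by (auto simp: mpoly_ring_def)
  qed (auto simp: mpoly_ring_def mult_ac)
qed (auto simp: mpoly_ring_def ring_distribs)

lemma mvar_in_carrier: "v \<in> V \<Longrightarrow> mvar v \<in> carrier (mpoly_ring V)"
  by (auto simp: mvar_def mpoly_ring_def)


section \<open>Powers, colon ideals, integral closure, associated primes\<close>

text \<open>
  Powers of ideals are taken in the library's monoid \<^const>\<open>ideals_set\<close> of ideals under
  \<^const>\<open>ideal_prod\<close>, whose unit is the whole ring.
\<close>

abbreviation ideal_pow :: "('a, 'b) ring_scheme \<Rightarrow> 'a set \<Rightarrow> nat \<Rightarrow> 'a set" where
  "ideal_pow R I t \<equiv> I [^]\<^bsub>ideals_set R\<^esub> t"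

definition colon_ideal :: "('a, 'b) ring_scheme \<Rightarrow> 'a set \<Rightarrow> 'a set \<Rightarrow> 'a set" where
  "colon_ideal R I J = {r \<in> carrier R. \<forall>a\<in>J. r \<otimes>\<^bsub>R\<^esub> a \<in> I}"

definition integral_over :: "('a, 'b) ring_scheme \<Rightarrow> 'a set \<Rightarrow> 'a \<Rightarrow> bool" where
  "integral_over R I f \<longleftrightarrow>
    (\<exists>(k::nat) c. k \<ge> 1 \<and> (\<forall>i\<in>{1..k}. c i \<in> ideal_pow R I i) \<and>
      f [^]\<^bsub>R\<^esub> k \<oplus>\<^bsub>R\<^esub> (\<Oplus>\<^bsub>R\<^esub>i\<in>{1..k}. c i \<otimes>\<^bsub>R\<^esub> f [^]\<^bsub>R\<^esub> (k - i)) = \<zero>\<^bsub>R\<^esub>)"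

definition integral_closure :: "('a, 'b) ring_scheme \<Rightarrow> 'a set \<Rightarrow> 'a set" where
  "integral_closure R I = {f \<in> carrier R. integral_over R I f}"

definition integrally_closed :: "('a, 'b) ring_scheme \<Rightarrow> 'a set \<Rightarrow> bool" where
  "integrally_closed R I \<longleftrightarrow> I = integral_closure R I"

definition normal_ideal :: "('a, 'b) ring_scheme \<Rightarrow> 'a set \<Rightarrow> bool" where
  "normal_ideal R I \<longleftrightarrow> (\<forall>t\<ge>1. integrally_closed R (ideal_pow R I t))"

text \<open>
  \<open>Ass\<^sub>R(R/I)\<close>: the prime ideals that are the annihilator in \<open>R\<close> of an element of the
  \<open>R\<close>-module \<open>R/I\<close>. An element \<open>r\<close> of \<open>R\<close> acts on \<open>R/I\<close> as multiplication by its coset.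
\<close>

definition Ass_quot :: "('a, 'b) ring_scheme \<Rightarrow> 'a set \<Rightarrow> 'a set set" where
  "Ass_quot R I =
    {P. primeideal P R \<and>
        (\<exists>m\<in>carrier (R Quot I).
          P = {r \<in> carrier R. (I +>\<^bsub>R\<^esub> r) \<otimes>\<^bsub>R Quot I\<^esub> m = \<zero>\<^bsub>R Quot I\<^esub>})}"

definition persistence_property :: "('a, 'b) ring_scheme \<Rightarrow> 'a set \<Rightarrow> bool" where
  "persistence_property R I \<longleftrightarrow>
    (\<forall>k\<ge>1. Ass_quot R (ideal_pow R I k) \<subseteq> Ass_quot R (ideal_pow R I (k + 1)))"

definition strong_persistence_property :: "('a, 'b) ring_scheme \<Rightarrow> 'a set \<Rightarrow> bool" where
  "strong_persistence_property R I \<longleftrightarrow>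
    (\<forall>k\<ge>1. colon_ideal R (ideal_pow R I (k + 1)) I = ideal_pow R I k)"


section \<open>Graphs and cover ideals\<close>

record 'v ugraph =
  vertices :: "'v set"
  edges :: "'v set set"

definition finite_simple_graph :: "'v ugraph \<Rightarrow> bool" where
  "finite_simple_graph G \<longleftrightarrow>
    finite (vertices G) \<and> (\<forall>e\<in>edges G. e \<subseteq> vertices G \<and> card e = 2)"

definition vertex_cover :: "'v ugraph \<Rightarrow> 'v set \<Rightarrow> bool" where
  "vertex_cover G W \<longleftrightarrow> W \<subseteq> vertices G \<and> (\<forall>e\<in>edges G. W \<inter> e \<noteq> {})"

definition minimal_vertex_cover :: "'v ugraph \<Rightarrow> 'v set \<Rightarrow> bool" where
  "minimal_vertex_cover G W \<longleftrightarrow> vertex_cover G W \<and> (\<forall>W'. W' \<subset> W \<longrightarrow> \<not> vertex_cover G W')"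

definition cover_ideal :: "'v ugraph \<Rightarrow> ('v, 'k::field) mpoly set" where
  "cover_ideal G =
    Idl\<^bsub>mpoly_ring (vertices G)\<^esub> {(\<Prod>u\<in>W. mvar u) | W. minimal_vertex_cover G W}"

text \<open>The edges of the cycle \<open>1, 2, \<dots>, k\<close>, meaningful for \<open>k \<ge> 3\<close>.\<close>

definition cycle_edges :: "nat \<Rightarrow> nat set set" where
  "cycle_edges k = {{i, i + 1} | i. 1 \<le> i \<and> i < k} \<union> {{k, 1}}"

text \<open>The wheel of order \<open>m\<close> (so with \<open>m - 1\<close> spokes); the hub is \<open>m\<close>.\<close>

definition wheel_graph :: "nat \<Rightarrow> nat ugraph" where
  "wheel_graph m =
    \<lparr>vertices = {1..m}, edges = cycle_edges (m - 1) \<union> {{m, i} | i. 1 \<le> i \<and> i \<le> m - 1}\<rparr>"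

text \<open>The pendant vertex attached to the vertex \<open>i\<close> of the outer cycle is \<open>m + 1 + i\<close>.\<close>

definition helm_graph :: "nat \<Rightarrow> nat ugraph" where
  "helm_graph m =
    \<lparr>vertices = vertices (wheel_graph (m + 1)) \<union> {m + 1 + i | i. 1 \<le> i \<and> i \<le> m},
     edges = edges (wheel_graph (m + 1)) \<union> {{i, m + 1 + i} | i. 1 \<le> i \<and> i \<le> m}\<rparr>"

lemma vertices_helm_graph: "vertices (helm_graph m) = {1..2 * m + 1}"
proof -
  have "x \<in> {m + 1 + i | i. 1 \<le> i \<and> i \<le> m} \<longleftrightarrow> m + 2 \<le> x \<and> x \<le> 2 * m + 1" for x
    by (auto intro!: exI[of _ "x - (m + 1)"])
  then show ?thesis
    by (auto simp: helm_graph_def wheel_graph_def)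
qed

lemma finite_simple_graph_helm_graph:
  assumes "m \<ge> 3"
  shows "finite_simple_graph (helm_graph m)"
  unfolding finite_simple_graph_def vertices_helm_graph using assms
  by (auto simp: helm_graph_def wheel_graph_def cycle_edges_def card_insert_if)

lemma ideal_cover_ideal:
  assumes "finite_simple_graph G"
  shows "ideal (cover_ideal G :: ('v, 'k::field) mpoly set) (mpoly_ring (vertices G))"
proof -
  let ?R = "mpoly_ring (vertices G) :: ('v, 'k) mpoly ring"
  interpret cring ?R by (rule cring_mpoly_ring)
  have "(\<Prod>u\<in>W. mvar u) \<in> carrier ?R" if "W \<subseteq> vertices G" for W
  proof -
    have "finite W"
      using that assms finite_subset by (auto simp: finite_simple_graph_def)
    then show ?thesis using that
    proof induction
      case empty
      then show ?case using one_closed by (simp add: mpoly_ring_def)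
    next
      case (insert u W)
      then show ?case
        using m_closed[of "mvar u" "\<Prod>u\<in>W. mvar u"] mvar_in_carrier[of u "vertices G"]
        by (simp add: mpoly_ring_def)
    qed
  qed
  then show ?thesis
    unfolding cover_ideal_def
    by (intro genideal_ideal) (auto simp: minimal_vertex_cover_def vertex_cover_def)
qed

end

theory Submission
  imports Defs
begin

text \<open>
  A monomial \<open>x\<^sup>m\<close> lies in \<open>J\<^sup>t\<close> iff the helm graph has \<open>t\<close> vertex covers that together use each
  vertex \<open>v\<close> at most \<open>m\<^sub>v\<close> times, that is, iff the graph with demands \<open>t - m\<^sub>v\<close> can be multicoloured
  with \<open>t\<close> colours. For an odd cycle the obvious necessary conditions, from the edges and from
  the independence number, suffice for a multicolouring; hub and pendant vertices reduce to this. So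
  the exponents of \<open>J\<^sup>t\<close> are cut out by finitely many inequalities \<open>c t \<le> l(m)\<close> with \<open>l\<close> additive. Each
  \<open>l\<close> is a monomial valuation, which makes all powers integrally closed, and each inequality is tight at
  some vertex cover, which gives \<open>(J\<^sup>k\<^sup>+\<^sup>1 : J) = J\<^sup>k\<close>.
\<close>

section \<open>Multicolourings of odd cycles\<close>

text \<open>Normality is here an integer decomposition statement: a lattice point satisfying the
  inequalities scaled by \<open>t\<close> has to split into \<open>t\<close> covers without any
  rounding loss. The weights must be additive, yet two quantities in the colouring problem are not
  linear in m: the demand of a vertex v is max(t - m_v, 0), and beside the hub h only min(m_h, t)
  colours remain for the cycle. The minimum is resolved by imposing each cycle condition twice, once
  against t and once against m_h; this produces the triangle inequalities and the one with constant
  2n+1. In the edge conditions, truncation of the demands is absorbed by the inequalities of the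
  spokes. In the sum over the whole cycle it is harmless: a cycle vertex of demand 0 leaves a path
  with a perfect matching, so the edge conditions already bound the sum, and if no demand is 0 then
  nothing has been truncated.\<close>

lemma sum_consecutive_pairs_le:
  fixes b :: "nat \<Rightarrow> nat"
  assumes "\<And>i. a < i \<Longrightarrow> i < a + 2 * k \<Longrightarrow> b i + b (i + 1) \<le> s"
  shows "(\<Sum>i=a+1..a+2*k. b i) \<le> k * s"
  using assms
proof (induction k)
  case (Suc k)
  have "b (a + 2 * k + 1) + b (a + 2 * k + 1 + 1) \<le> s"
    by (rule Suc.prems) auto
  moreover have "(\<Sum>i=a+1..a+2*k. b i) \<le> k * s"
    using Suc by simp
  ultimately show ?case
    by simp
qed simp

text \<open>Deleting \<open>j\<close> from the cycle leaves a path on \<open>2 * n\<close> vertices,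
  which \<open>n\<close> disjoint edges cover. The parity of \<open>j\<close> decides whether this
  matching uses the closing edge.\<close>

lemma odd_cycle_sum_le_if_zero:
  fixes b :: "nat \<Rightarrow> nat"
  assumes path: "\<And>i. 1 \<le> i \<Longrightarrow> i \<le> 2 * n \<Longrightarrow> b i + b (i + 1) \<le> s"
    and ends: "b (2 * n + 1) + b 1 \<le> s"
    and j: "1 \<le> j" "j \<le> 2 * n + 1" "b j = 0"
  shows "(\<Sum>i=1..2*n+1. b i) \<le> n * s"
proof -
  have split: "(\<Sum>i=1..2*n+1. b i) = (\<Sum>i=1..p. b i) + (\<Sum>i=p+1..2*n+1. b i)"
    if "p \<le> 2 * n + 1" for p
    using that sum.ub_add_nat[of 1 p b "2 * n + 1 - p"] by simp
  show ?thesis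
  proof (cases "odd j")
    case True
    then obtain k where k: "j = 2 * k + 1" by (auto elim: oddE)
    have "k \<le> n" using k j by simp
    then have last: "j + 2 * (n - k) = 2 * n + 1" using k by simp
    have "(\<Sum>i=1..2*n+1. b i) = (\<Sum>i=0+1..0+2*k. b i) + (b j + (\<Sum>i=j+1..j+2*(n-k). b i))"
      unfolding last
      using split[of "2 * k"] \<open>k \<le> n\<close> k sum.atLeast_Suc_atMost[of j "2 * n + 1" b] by simp
    also have "\<dots> \<le> k * s + (0 + (n - k) * s)"
      using \<open>k \<le> n\<close> k j(3) by (intro add_mono sum_consecutive_pairs_le path) auto
    finally show ?thesis
      using \<open>k \<le> n\<close> by (simp flip: add_mult_distrib)
  next
    case False
    then obtain k where k: "j = 2 * k" by (auto elim: evenE)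
    with j obtain k' where k': "k = Suc k'" by (cases k) auto
    have "k' < n" using k k' j by simp
    then have last: "j + 2 * (n - k) = 2 * n" using k k' by simp
    have "(\<Sum>i=1..2*n+1. b i) = b 1 + (\<Sum>i=2..j-1. b i) + (b j + (\<Sum>i=j+1..2*n. b i) + b (2 * n + 1))"
      using split[of "j - 1"] \<open>k' < n\<close> k k' sum.atLeast_Suc_atMost[of j "2 * n" b]
        sum.atLeast_Suc_atMost[of 1 "j - 1" b]
      by (simp add: numeral_2_eq_2)
    also have "\<dots> = (\<Sum>i=1+1..1+2*k'. b i) + (\<Sum>i=j+1..j+2*(n-k). b i) + (b (2 * n + 1) + b 1)"
      unfolding last using j k k' by (simp add: numeral_2_eq_2)
    also have "\<dots> \<le> k' * s + (n - k) * s + s"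
      using \<open>k' < n\<close> k k' ends by (intro add_mono sum_consecutive_pairs_le path) auto
    also have "\<dots> = (k' + (n - k) + 1) * s"
      by (simp add: algebra_simps)
    finally show ?thesis
      using \<open>k' < n\<close> k' by simp
  qed
qed

text \<open>Fill the set from \<open>X\<close> and touch \<open>Y\<close> only when \<open>X\<close>
  is exhausted; the final disjunction records where the filling stopped.\<close>

lemma ex_subset_card_preferring:
  assumes "finite X" "finite Y" "X \<inter> Y = {}" "k \<le> card X + card Y"
  shows "\<exists>C\<subseteq>X \<union> Y. card C = k \<and> (C \<subseteq> X \<or> X \<subseteq> C)"
proof (cases "k \<le> card X")
  case True
  then obtain C where "C \<subseteq> X" "card C = k"
    by (meson obtain_subset_with_card_n)
  then show ?thesis by blast
next
  case False
  then have "k - card X \<le> card Y" using assms(4) by simp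
  then obtain C where C: "C \<subseteq> Y" "card C = k - card X"
    by (meson obtain_subset_with_card_n)
  have "card (X \<union> C) = k"
    using C False assms finite_subset[of C Y] by (subst card_Un_disjoint) auto
  then show ?thesis using C by (intro exI[of _ "X \<union> C"]) auto
qed

text \<open>\<open>C\<close> prefers \<open>B\<close>, and \<open>D\<close> avoids \<open>B\<close>
  as long as it can. Given \<open>A\<close>, each of the three values in the disjunction is a lower
  bound for the overlap of \<open>D\<close> and \<open>B\<close>, so the choice is optimal: 0, the
  excess of \<open>d + card B\<close> over \<open>card U\<close>, and the excess forced because
  \<open>C\<close> cannot use up the part of \<open>B\<close> inside \<open>A\<close>.\<close>

lemma two_step_multicolouring:
  assumes U: "finite U" "A \<subseteq> U" "B \<subseteq> U"
    and ac: "card A + c \<le> card U" and cd: "c + d \<le> card U"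
  shows "\<exists>C D. C \<subseteq> U \<and> D \<subseteq> U \<and> card C = c \<and> card D = d \<and> A \<inter> C = {} \<and> C \<inter> D = {} \<and>
    (card (D \<inter> B) = 0 \<or> card (D \<inter> B) + card U = d + card B \<or>
     card (D \<inter> B) + card U = c + d + card (A \<inter> B))"
proof -
  have fin: "finite A" "finite B" "finite U" using U finite_subset by auto
  have U_A: "(B - A) \<union> (U - A - B) = U - A" using U by auto
  have "card (B - A) + card (U - A - B) = card (U - A)"
    using fin by (subst card_Un_disjoint[symmetric]) (auto simp: U_A)
  also have "\<dots> = card U - card A" using fin U by (simp add: card_Diff_subset)
  finally have "c \<le> card (B - A) + card (U - A - B)" using ac by simp
  then have "\<exists>C\<subseteq>(B - A) \<union> (U - A - B). card C = c \<and> (C \<subseteq> B - A \<or> B - A \<subseteq> C)"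
    using fin by (intro ex_subset_card_preferring) auto
  then obtain C where C: "C \<subseteq> U - A" "card C = c" "C \<subseteq> B - A \<or> B - A \<subseteq> C"
    unfolding U_A by blast
  have finC: "finite C" using C(1) fin finite_subset by blast
  have U_C: "(U - C - B) \<union> (B - C) = U - C" using U by auto
  have "card (U - C - B) + card (B - C) = card (U - C)"
    using fin by (subst card_Un_disjoint[symmetric]) (auto simp: U_C)
  also have "\<dots> = card U - c" using finC C by (subst card_Diff_subset) auto
  finally have *: "card (U - C - B) + card (B - C) = card U - c" .
  then have "d \<le> card (U - C - B) + card (B - C)" using cd by simp
  then have "\<exists>D\<subseteq>(U - C - B) \<union> (B - C). card D = d \<and> (D \<subseteq> U - C - B \<or> U - C - B \<subseteq> D)"
    using fin by (intro ex_subset_card_preferring) auto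
  then obtain D where D: "D \<subseteq> U - C" "card D = d" "D \<subseteq> U - C - B \<or> U - C - B \<subseteq> D"
    unfolding U_C by blast
  have finD: "finite D" using D(1) fin finite_subset by blast
  have "card (D \<inter> B) = 0 \<or> card (D \<inter> B) + card U = d + card B \<or>
     card (D \<inter> B) + card U = c + d + card (A \<inter> B)"
    using D(3)
  proof
    assume "D \<subseteq> U - C - B"
    then have "D \<inter> B = {}" by auto
    then show ?thesis by simp
  next
    assume sub: "U - C - B \<subseteq> D"
    have D_eq: "(D \<inter> B) \<union> (U - C - B) = D" using sub D(1) by auto
    have "card (D \<inter> B) + card (U - C - B) = card D"
      using fin finD by (subst card_Un_disjoint[symmetric]) (auto simp: D_eq)
    with * D(2) cd have **: "card (D \<inter> B) + card U = d + c + card (B - C)" by simp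
    from C(3) show ?thesis
    proof
      assume "C \<subseteq> B - A"
      then have "C \<subseteq> B" by auto
      then have "card (B - C) + c = card B"
        using card_Diff_subset[OF finC] C(2) card_mono[OF fin(2)] by fastforce
      then show ?thesis using ** by simp
    next
      assume "B - A \<subseteq> C"
      then have "B - C = A \<inter> B" using C(1) by auto
      then show ?thesis using ** by simp
    qed
  qed
  with C(1,2) D(1,2) show ?thesis
    by (intro exI[of _ C] exI[of _ D] conjI) auto
qed

text \<open>
  The cycle is coloured greedily, two vertices at a time: the odd-numbered vertices meet the colour
  set of vertex 1 as little as possible, the even-numbered ones as much as possible.
\<close>

lemma odd_cycle_multicolouring:
  fixes b :: "nat \<Rightarrow> nat"
  assumes path: "\<And>i. 1 \<le> i \<Longrightarrow> i \<le> 2 * n \<Longrightarrow> b i + b (i + 1) \<le> s"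
    and ends: "b (2 * n + 1) + b 1 \<le> s"
    and total: "(\<Sum>i=1..2*n+1. b i) \<le> n * s"
  shows "\<exists>B. (\<forall>i\<in>{1..2*n+1}. B i \<subseteq> {..<s} \<and> card (B i) = b i) \<and>
    (\<forall>i\<in>{1..2*n}. B i \<inter> B (i + 1) = {}) \<and> B (2 * n + 1) \<inter> B 1 = {}"
proof -
  \<comment> \<open>The last conjunct carries the induction: for \<open>j = 0\<close> the overlap is
    \<open>b 1\<close> and it is the hypothesis \<open>total\<close>; for \<open>j = n\<close> it
    forces the overlap of the two ends of the closing edge to be empty.\<close>
  have "\<exists>B. (\<forall>i\<in>{1..2*j+1}. B i \<subseteq> {..<s} \<and> card (B i) = b i) \<and>
    (\<forall>i\<in>{1..2*j}. B i \<inter> B (i + 1) = {}) \<and>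
    card (B (2 * j + 1) \<inter> B 1) + (\<Sum>i=2*j+2..2*n+1. b i) \<le> (n - j) * s" if "j \<le> n" for j
    using that
  proof (induction j)
    case 0
    have "b 1 \<le> s" using ends by simp
    moreover have "b 1 + (\<Sum>i=2..2*n+1. b i) \<le> n * s"
      using total sum.atLeast_Suc_atMost[of 1 "2 * n + 1" b] by (simp add: numeral_2_eq_2)
    ultimately show ?case
      by (intro exI[of _ "\<lambda>_. {..<b 1}"]) (auto simp: numeral_2_eq_2)
  next
    case (Suc j)
    then have "j \<le> n" by simp
    from Suc.IH[OF this] obtain B
      where B: "\<forall>i\<in>{1..2*j+1}. B i \<subseteq> {..<s} \<and> card (B i) = b i"
      "\<forall>i\<in>{1..2*j}. B i \<inter> B (i + 1) = {}"
      and inv: "card (B (2 * j + 1) \<inter> B 1) + (\<Sum>i=2*j+2..2*n+1. b i) \<le> (n - j) * s"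
      by (elim exE conjE)
    let ?k = "n - Suc j"
    have nj: "n - j = Suc ?k" using Suc.prems by simp
    have last: "2 * j + 3 + 2 * ?k = 2 * n + 1" "2 * j + 2 + 2 * ?k = 2 * n" using Suc.prems by simp_all
    have B': "B (2 * j + 1) \<subseteq> {..<s}" "card (B (2 * j + 1)) = b (2 * j + 1)"
      "B 1 \<subseteq> {..<s}" "card (B 1) = b 1"
      using bspec[OF B(1), of "2 * j + 1"] bspec[OF B(1), of 1] by simp_all
    have "b (2 * j + 1) + b (2 * j + 2) \<le> s" "b (2 * j + 2) + b (2 * j + 3) \<le> s"
      using path[of "2 * j + 1"] path[of "2 * j + 2"] Suc.prems by (auto simp: numeral_eq_Suc)
    then obtain C D where CD: "C \<subseteq> {..<s}" "D \<subseteq> {..<s}" "card C = b (2 * j + 2)"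
      "card D = b (2 * j + 3)" "B (2 * j + 1) \<inter> C = {}" "C \<inter> D = {}"
      and D: "card (D \<inter> B 1) = 0 \<or> card (D \<inter> B 1) + s = b (2 * j + 3) + b 1 \<or>
        card (D \<inter> B 1) + s = b (2 * j + 2) + b (2 * j + 3) + card (B (2 * j + 1) \<inter> B 1)"
      using two_step_multicolouring[of "{..<s}" "B (2 * j + 1)" "B 1"
        "b (2 * j + 2)" "b (2 * j + 3)"] B' by auto
    have rest: "(\<Sum>i=2*j+2..2*n+1. b i) = b (2 * j + 2) + b (2 * j + 3) + (\<Sum>i=2*j+4..2*n+1. b i)"
      using Suc.prems sum.atLeast_Suc_atMost[of "2 * j + 2" "2 * n + 1" b]
        sum.atLeast_Suc_atMost[of "2 * j + 3" "2 * n + 1" b]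
      by (simp add: numeral_eq_Suc)
    have tail: "(\<Sum>i=2*j+4..2*n+1. b i) \<le> ?k * s"
      using sum_consecutive_pairs_le[of "2 * j + 3" ?k b s] path unfolding last
      by (simp add: numeral_eq_Suc)
    have "(\<Sum>i=2*j+2+1..2*n. b i) \<le> ?k * s"
      using sum_consecutive_pairs_le[of "2 * j + 2" ?k b s] path unfolding last by simp
    moreover have "b (2 * j + 3) + (\<Sum>i=2*j+4..2*n+1. b i)
        = (\<Sum>i=2*j+2+1..2*n. b i) + b (2 * n + 1)"
      using Suc.prems sum.atLeast_Suc_atMost[of "2 * j + 3" "2 * n + 1" b]
      by (simp add: numeral_eq_Suc algebra_simps)
    ultimately have "b (2 * j + 3) + b 1 + (\<Sum>i=2*j+4..2*n+1. b i) \<le> ?k * s + s"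
      using ends by simp
    \<comment> \<open>One bound for each value of the overlap: \<open>tail\<close> if it is 0, the
      matching of \<open>2 * j + 3\<close> up to \<open>2 * n\<close> together with the closing edge
      for the second, and the previous invariant for the third.\<close>
    then have new: "card (D \<inter> B 1) + (\<Sum>i=2*j+4..2*n+1. b i) \<le> ?k * s"
      using D inv tail unfolding nj rest by auto
    let ?B = "B(2 * j + 2 := C, 2 * j + 3 := D)"
    have "?B i \<subseteq> {..<s} \<and> card (?B i) = b i" if "i \<in> {1..2 * Suc j + 1}" for i
      using that bspec[OF B(1), of i] CD(1-4) by (auto simp: numeral_eq_Suc le_Suc_eq)
    moreover have "?B i \<inter> ?B (i + 1) = {}" if "i \<in> {1..2 * Suc j}" for i
      using that bspec[OF B(2), of i] CD(5,6) by (auto simp: numeral_eq_Suc le_Suc_eq)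
    moreover have "card (?B (2 * Suc j + 1) \<inter> ?B 1) + (\<Sum>i=2 * Suc j+2..2*n+1. b i) \<le> ?k * s"
      using new by (simp add: numeral_eq_Suc)
    ultimately show ?case by blast
  qed
  from this[of n] obtain B where "\<forall>i\<in>{1..2*n+1}. B i \<subseteq> {..<s} \<and> card (B i) = b i"
    "\<forall>i\<in>{1..2*n}. B i \<inter> B (i + 1) = {}" "card (B (2 * n + 1) \<inter> B 1) = 0"
    by auto
  moreover from this have "finite (B 1)"
    using finite_subset[of "B 1" "{..<s}"] by auto
  ultimately show ?thesis by (intro exI[of _ B]) auto
qed

section \<open>Powers of ideals and persistence\<close>

context cring
begin

lemma ideal_ideal_pow:
  assumes "ideal I R"
  shows "ideal (ideal_pow R I t) R"
proof -
  interpret M: comm_monoid "ideals_set R" by (rule ideals_set_is_comm_monoid)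
  show ?thesis
    using M.nat_pow_closed[of I t] assms by (simp add: ideals_set_def)
qed

lemma ideal_pow_0: "ideal_pow R I 0 = carrier R"
  by (simp add: nat_pow_def ideals_set_def)

lemma ideal_pow_Suc: "ideal_pow R I (Suc t) = ideal_pow R I t \<cdot> I"
  by (simp add: nat_pow_def ideals_set_def)

lemma ideal_pow_mult:
  assumes "ideal I R"
  shows "ideal_pow R (ideal_pow R I t) i = ideal_pow R I (t * i)"
proof -
  interpret M: comm_monoid "ideals_set R" by (rule ideals_set_is_comm_monoid)
  show ?thesis
    using assms by (intro M.nat_pow_pow) (simp add: ideals_set_def)
qed

lemma ideal_pow_1:
  assumes "ideal I R"
  shows "ideal_pow R I 1 = I"
proof -
  interpret M: comm_monoid "ideals_set R" by (rule ideals_set_is_comm_monoid)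
  show ?thesis
    using assms M.l_one[of I] by (simp add: nat_pow_def ideals_set_def)
qed

lemma subset_integral_closure:
  assumes "ideal I R"
  shows "I \<subseteq> integral_closure R I"
proof
  fix f assume f: "f \<in> I"
  interpret ideal I R by fact
  have fR: "f \<in> carrier R" using f by simp
  have "\<ominus> f \<in> I" using f by simp
  moreover have "f [^] (1::nat) \<oplus> (\<Oplus>i\<in>{1..1::nat}. (\<ominus> f) \<otimes> f [^] (1 - i)) = \<zero>"
    using fR by (simp add: r_neg)
  ultimately show "f \<in> integral_closure R I"
    unfolding integral_closure_def integral_over_def using fR assms
    by (intro CollectI conjI exI[of _ "1::nat"] exI[of _ "\<lambda>_. \<ominus> f"]) (auto simp: ideal_pow_1[simplified])
qed

text \<open>Choosing representatives of cosets turns an associated prime into a colon ideal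
  \<open>(I : f)\<close> inside \<open>R\<close>.\<close>

lemma Ass_quot_eq:
  assumes "ideal I R"
  shows "Ass_quot R I =
    {P. primeideal P R \<and> (\<exists>f\<in>carrier R. P = {r \<in> carrier R. r \<otimes> f \<in> I})}"
proof -
  interpret ideal I R by fact
  have "(I +> r) \<otimes>\<^bsub>R Quot I\<^esub> (I +> f) = \<zero>\<^bsub>R Quot I\<^esub> \<longleftrightarrow> r \<otimes> f \<in> I"
    if "r \<in> carrier R" "f \<in> carrier R" for r f
    using that a_rcos_self[of "r \<otimes> f"] a_rcos_const[of "r \<otimes> f"]
    by (auto simp: FactRing_def rcoset_mult_add)
  then have "(\<exists>m\<in>carrier (R Quot I).
      P = {r \<in> carrier R. (I +> r) \<otimes>\<^bsub>R Quot I\<^esub> m = \<zero>\<^bsub>R Quot I\<^esub>})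
    \<longleftrightarrow> (\<exists>f\<in>carrier R. P = {r \<in> carrier R. r \<otimes> f \<in> I})" for P
    by (auto simp: FactRing_def A_RCOSETS_def' cong: conj_cong)
  then show ?thesis
    unfolding Ass_quot_def by simp
qed

text \<open>Allows the condition \<open>r \<otimes> a \<in> I\<close>, for all \<open>a\<close> in
  an ideal, to be tested on generators of that ideal.\<close>

lemma ideal_colon:
  assumes "ideal I R" "r \<in> carrier R"
  shows "ideal {a \<in> carrier R. r \<otimes> a \<in> I} R"
proof -
  interpret ideal I R by fact
  show ?thesis
  proof (intro idealI subgroup.intro)
    fix a x assume a: "a \<in> {a \<in> carrier R. r \<otimes> a \<in> I}" and x: "x \<in> carrier R"
    have "r \<otimes> (a \<otimes> x) = r \<otimes> a \<otimes> x"
      using a x assms(2) by (simp add: m_assoc)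
    then show "a \<otimes> x \<in> {a \<in> carrier R. r \<otimes> a \<in> I}"
      using a x by (simp add: I_r_closed)
    then show "x \<otimes> a \<in> {a \<in> carrier R. r \<otimes> a \<in> I}"
      using a x by (simp add: m_comm)
  next
    fix a assume a: "a \<in> {a \<in> carrier R. r \<otimes> a \<in> I}"
    then have "r \<otimes> (\<ominus> a) \<in> I" using assms(2) by (simp add: r_minus)
    then show "inv\<^bsub>add_monoid R\<^esub> a \<in> {a \<in> carrier R. r \<otimes> a \<in> I}"
      using a by (simp add: a_inv_def[symmetric])
  qed (use assms(2) in \<open>auto simp: ring_axioms r_distr\<close>)
qed

text \<open>The product of the witnesses stays outside \<open>P\<close> because \<open>P\<close> is
  prime. This is the contrapositive of the fact that a prime containing a finite intersection of
  ideals contains one of them, for the ideals \<open>(I : g a)\<close>.\<close>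

lemma primeideal_avoid_finite_colon:
  assumes P: "primeideal P R" and I: "ideal I R"
    and fin: "finite A" and g: "\<And>a. a \<in> A \<Longrightarrow> g a \<in> carrier R"
    and ex: "\<And>a. a \<in> A \<Longrightarrow> \<exists>r\<in>carrier R. r \<notin> P \<and> r \<otimes> g a \<in> I"
  shows "\<exists>r\<in>carrier R. r \<notin> P \<and> (\<forall>a\<in>A. r \<otimes> g a \<in> I)"
  using fin g ex
proof (induction A)
  case empty
  interpret P: primeideal P R by fact
  have "\<one> \<notin> P" using P.I_notcarr P.one_imp_carrier by blast
  then show ?case by (intro bexI[of _ \<one>]) simp_all
next
  case (insert a B)
  interpret P: primeideal P R by fact
  interpret I: ideal I R by fact
  have "\<exists>r\<in>carrier R. r \<notin> P \<and> (\<forall>a\<in>B. r \<otimes> g a \<in> I)"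
    using insert.prems by (intro insert.IH) simp_all
  then obtain r where r: "r \<in> carrier R" "r \<notin> P" "\<forall>a\<in>B. r \<otimes> g a \<in> I"
    by (elim bexE conjE) (rule that)
  obtain s where s: "s \<in> carrier R" "s \<notin> P" "s \<otimes> g a \<in> I"
    using insert.prems(2)[OF insertI1] by (elim bexE conjE) (rule that)
  have sr: "s \<otimes> r \<in> carrier R" using r(1) s(1) by simp
  have "s \<otimes> r \<notin> P" using P.I_prime[OF s(1) r(1)] r(2) s(2) by blast
  moreover have "s \<otimes> r \<otimes> g b \<in> I" if b: "b \<in> insert a B" for b
  proof -
    have gb: "g b \<in> carrier R" by (rule insert.prems(1)[OF b])
    from b show ?thesis
    proof
      assume "b = a"
      then have "r \<otimes> (s \<otimes> g b) \<in> I" using I.I_l_closed[OF s(3) r(1)] by simp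
      moreover have "s \<otimes> r \<otimes> g b = r \<otimes> (s \<otimes> g b)"
        using m_comm[OF s(1) r(1)] m_assoc[OF r(1) s(1) gb] by simp
      ultimately show ?thesis by simp
    next
      assume "b \<in> B"
      then have "s \<otimes> (r \<otimes> g b) \<in> I" using I.I_l_closed[OF bspec[OF r(3)] s(1)] by simp
      then show ?thesis by (simp add: m_assoc[OF s(1) r(1) gb])
    qed
  qed
  ultimately show ?case using sr by (intro bexI[of _ "s \<otimes> r"] conjI ballI)
qed

text \<open>
  Let \<open>P = (I\<^sup>k : f)\<close> and let \<open>A\<close> be a finite generating set of \<open>I\<close>. Strong persistence turns \<open>P\<close>
  into \<open>(I\<^sup>k\<^sup>+\<^sup>1 : f I)\<close>, the intersection of the ideals \<open>(I\<^sup>k\<^sup>+\<^sup>1 : f a)\<close> for \<open>a \<in> A\<close>. A prime that is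
  a finite intersection of ideals equals one of them.
\<close>

lemma persistence_property_if_strong:
  assumes A: "finite A" "A \<subseteq> carrier R" and strong: "strong_persistence_property R (Idl A)"
  shows "persistence_property R (Idl A)"
  unfolding persistence_property_def
proof (intro allI impI subsetI)
  fix k :: nat and P
  let ?I = "Idl A" and ?Ik = "ideal_pow R (Idl A) (k + 1)"
  assume "1 \<le> k" and P_Ass: "P \<in> Ass_quot R (ideal_pow R ?I k)"
  have I: "ideal ?I R" by (rule genideal_ideal[OF A(2)])
  interpret Ik: ideal ?Ik R by (rule ideal_ideal_pow[OF I])
  obtain f where P: "primeideal P R" and f: "f \<in> carrier R"
    and P_eq: "P = {r \<in> carrier R. r \<otimes> f \<in> ideal_pow R ?I k}"
    using P_Ass unfolding Ass_quot_eq[OF ideal_ideal_pow[OF I]] by blast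
  interpret P: primeideal P R by fact
  have colon: "colon_ideal R ?Ik ?I = ideal_pow R ?I k"
    using strong \<open>1 \<le> k\<close> unfolding strong_persistence_property_def by blast
  have fa: "f \<otimes> a \<in> carrier R" if "a \<in> A" for a
    using that f A(2) by auto
  have P_iff: "r \<in> P \<longleftrightarrow> (\<forall>a\<in>A. r \<otimes> (f \<otimes> a) \<in> ?Ik)" if r: "r \<in> carrier R" for r
  proof -
    have rf: "r \<otimes> f \<in> carrier R" using r f by simp
    have "r \<in> P \<longleftrightarrow> r \<otimes> f \<in> colon_ideal R ?Ik ?I"
      unfolding colon P_eq using r by blast
    also have "\<dots> \<longleftrightarrow> (\<forall>a\<in>?I. r \<otimes> f \<otimes> a \<in> ?Ik)"
      unfolding colon_ideal_def using rf by blast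
    also have "\<dots> \<longleftrightarrow> ?I \<subseteq> {a \<in> carrier R. r \<otimes> f \<otimes> a \<in> ?Ik}"
      using ideal.Icarr[OF I] by blast
    also have "\<dots> \<longleftrightarrow> A \<subseteq> {a \<in> carrier R. r \<otimes> f \<otimes> a \<in> ?Ik}"
      by (rule Idl_subset_ideal[OF ideal_colon[OF Ik.ideal_axioms rf] A(2)])
    also have "\<dots> \<longleftrightarrow> (\<forall>a\<in>A. r \<otimes> f \<otimes> a \<in> ?Ik)"
      using A(2) by blast
    also have "\<dots> \<longleftrightarrow> (\<forall>a\<in>A. r \<otimes> (f \<otimes> a) \<in> ?Ik)"
      by (intro ball_cong arg_cong[of _ _ "\<lambda>x. x \<in> ?Ik"] refl m_assoc r f) (use A(2) in blast)
    finally show ?thesis .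
  qed
  have "\<exists>a\<in>A. \<forall>r\<in>carrier R. r \<otimes> (f \<otimes> a) \<in> ?Ik \<longrightarrow> r \<in> P"
  proof (rule ccontr)
    assume "\<not> ?thesis"
    then have "\<exists>r\<in>carrier R. r \<notin> P \<and> r \<otimes> (f \<otimes> a) \<in> ?Ik" if "a \<in> A" for a
      using that by blast
    then have "\<exists>r\<in>carrier R. r \<notin> P \<and> (\<forall>a\<in>A. r \<otimes> (f \<otimes> a) \<in> ?Ik)"
      using fa by (intro primeideal_avoid_finite_colon[OF P Ik.ideal_axioms A(1)])
    then show False using P_iff by blast
  qed
  then obtain a where "a \<in> A" and a: "\<forall>r\<in>carrier R. r \<otimes> (f \<otimes> a) \<in> ?Ik \<longrightarrow> r \<in> P" ..
  have "P = {r \<in> carrier R. r \<otimes> (f \<otimes> a) \<in> ?Ik}"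
  proof (intro equalityI subsetI)
    fix r assume r: "r \<in> P"
    then have "\<forall>a\<in>A. r \<otimes> (f \<otimes> a) \<in> ?Ik" using P_iff[OF P.Icarr[OF r]] by (simp only:)
    then show "r \<in> {r \<in> carrier R. r \<otimes> (f \<otimes> a) \<in> ?Ik}"
      using P.Icarr[OF r] \<open>a \<in> A\<close> by blast
  qed (use a in blast)
  then show "P \<in> Ass_quot R ?Ik"
    unfolding Ass_quot_eq[OF Ik.ideal_axioms] using P fa[OF \<open>a \<in> A\<close>] by blast
qed

end

section \<open>Monomial ideals\<close>

text \<open>Monomial ideals are encoded by a condition on supports. Sums then need no argument and
  products become sumsets of exponents, so ideal arithmetic reduces to arithmetic of exponent
  sets.\<close>

definition monomial_span :: "('v \<Rightarrow>\<^sub>0 nat) set \<Rightarrow> ('v, 'k::zero) mpoly set" where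
  "monomial_span E = {p. Poly_Mapping.keys p \<subseteq> E}"

lemma monomial_span_mono: "E \<subseteq> F \<Longrightarrow> monomial_span E \<subseteq> monomial_span F"
  by (auto simp: monomial_span_def)

lemma zero_in_monomial_span: "0 \<in> monomial_span E"
  by (simp add: monomial_span_def)

lemma add_in_monomial_span:
  fixes p q :: "('v, 'k::comm_monoid_add) mpoly"
  shows "p \<in> monomial_span E \<Longrightarrow> q \<in> monomial_span E \<Longrightarrow> p + q \<in> monomial_span E"
  using keys_add[of p q] by (auto simp: monomial_span_def)

lemma uminus_in_monomial_span:
  fixes p :: "('v, 'k::ab_group_add) mpoly"
  shows "p \<in> monomial_span E \<Longrightarrow> - p \<in> monomial_span E"
  by (simp add: monomial_span_def)

lemma sum_in_monomial_span:
  fixes p :: "'i \<Rightarrow> ('v, 'k::comm_monoid_add) mpoly"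
  assumes "\<And>i. i \<in> A \<Longrightarrow> p i \<in> monomial_span E"
  shows "sum p A \<in> monomial_span E"
  using assms
  by (induction A rule: infinite_finite_induct) (auto simp: zero_in_monomial_span intro: add_in_monomial_span)

lemma mult_in_monomial_span:
  fixes p q :: "('v, 'k::comm_semiring_0) mpoly"
  assumes "p \<in> monomial_span E" "q \<in> monomial_span F"
  shows "p * q \<in> monomial_span {a + b | a b. a \<in> E \<and> b \<in> F}"
  using assms keys_mult[of p q] by (fastforce simp: monomial_span_def)

lemma single_in_monomial_span: "m \<in> E \<Longrightarrow> Poly_Mapping.single m c \<in> monomial_span E"
  by (auto simp: monomial_span_def)

lemma monomial_span_induct [consumes 1, case_names zero single add]:
  fixes p :: "('v, 'k::comm_monoid_add) mpoly"
  assumes "p \<in> monomial_span E"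
    and "P 0"
    and "\<And>m c. m \<in> E \<Longrightarrow> P (Poly_Mapping.single m c)"
    and "\<And>p q. P p \<Longrightarrow> P q \<Longrightarrow> P (p + q)"
  shows "P p"
proof -
  have "p = (\<Sum>m\<in>Poly_Mapping.keys p. Poly_Mapping.single m (Poly_Mapping.lookup p m))"
    by (rule poly_mapping_eqI)
      (auto simp: lookup_sum lookup_single when_def in_keys_iff)
  moreover have "P (\<Sum>m\<in>B. Poly_Mapping.single m (Poly_Mapping.lookup p m))"
    if "B \<subseteq> Poly_Mapping.keys p" for B
    using finite_subset[OF that finite_keys] that assms
    by induction (auto simp: monomial_span_def)
  ultimately show ?thesis by (metis order_refl)
qed

text \<open>Multiplication by a monomial translates the support, so no terms cancel and a colon
  ideal can be examined one exponent at a time.\<close>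

lemma lookup_mult_single_add:
  fixes p :: "('v, 'k::comm_semiring_1) mpoly"
  shows "Poly_Mapping.lookup (p * Poly_Mapping.single a 1) (m + a) = Poly_Mapping.lookup p m"
proof -
  have "p \<in> monomial_span UNIV" by (simp add: monomial_span_def)
  then show ?thesis
    by (induction rule: monomial_span_induct)
      (auto simp: mult_single lookup_single when_def lookup_add distrib_right)
qed

lemma monomial_span_split:
  fixes f :: "('v, 'k::comm_monoid_add) mpoly"
  assumes "f \<in> monomial_span E"
  shows "\<exists>g h. f = g + h \<and> g \<in> monomial_span (E \<inter> {m. Q m}) \<and> h \<in> monomial_span (E \<inter> {m. \<not> Q m})"
  using assms
proof (induction rule: monomial_span_induct)
  case zero
  show ?case by (intro exI[of _ 0]) (simp add: zero_in_monomial_span)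
next
  case (single m c)
  show ?case
  proof (cases "Q m")
    case True
    then show ?thesis using single
      by (intro exI[of _ "Poly_Mapping.single m c"] exI[of _ 0])
        (simp add: zero_in_monomial_span single_in_monomial_span)
  next
    case False
    then show ?thesis using single
      by (intro exI[of _ "Poly_Mapping.single m c"] exI[of _ 0])
        (simp add: zero_in_monomial_span single_in_monomial_span)
  qed
next
  case (add p q)
  then obtain g h g' h' where
    "p = g + h" "g \<in> monomial_span (E \<inter> {m. Q m})" "h \<in> monomial_span (E \<inter> {m. \<not> Q m})"
    "q = g' + h'" "g' \<in> monomial_span (E \<inter> {m. Q m})" "h' \<in> monomial_span (E \<inter> {m. \<not> Q m})"
    by blast
  then show ?case
    by (intro exI[of _ "g + g'"] exI[of _ "h + h'"]) (simp add: add_in_monomial_span add_ac)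
qed

text \<open>
  An additive weight \<open>l\<close> on exponents is a valuation: the part \<open>g\<close> of \<open>f\<close> of least weight \<open>e\<close> satisfies
  \<open>g\<^sup>k \<noteq> 0\<close>, so \<open>f\<^sup>k\<close> has a term of weight \<open>k e\<close>. If \<open>e < d\<close>, all other terms of the
  integral equation have larger weight.
\<close>

lemma integral_equation_weight:
  fixes f :: "('v::linorder, 'k::idom) mpoly" and l :: "('v \<Rightarrow>\<^sub>0 nat) \<Rightarrow> nat"
  assumes l: "\<And>a b. l (a + b) = l a + l b"
    and k: "k \<ge> 1" and c: "\<And>i. i \<in> {1..k} \<Longrightarrow> c i \<in> monomial_span {m. d * i \<le> l m}"
    and eq: "f ^ k + (\<Sum>i\<in>{1..k}. c i * f ^ (k - i)) = 0"
  shows "f \<in> monomial_span {m. d \<le> l m}"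
proof (rule ccontr)
  assume "f \<notin> monomial_span {m. d \<le> l m}"
  then obtain m0 where m0: "m0 \<in> Poly_Mapping.keys f" "l m0 < d"
    by (auto simp: monomial_span_def subset_iff not_le)
  define S :: "nat \<Rightarrow> ('v, 'k) mpoly set" where "S j = monomial_span {m. j \<le> l m}" for j
  define e where "e = Min (l ` Poly_Mapping.keys f)"
  have e_le: "e \<le> l m" if "m \<in> Poly_Mapping.keys f" for m
    unfolding e_def using that by (intro Min_le) auto
  have "e \<in> l ` Poly_Mapping.keys f"
    unfolding e_def using m0 by (intro Min_in) auto
  then obtain m1 where m1: "m1 \<in> Poly_Mapping.keys f" "l m1 = e" by auto
  have "e < d" using e_le[OF m0(1)] m0(2) by simp
  have S_mult: "p * q \<in> S (i + j)" if "p \<in> S i" "q \<in> S j" for p q i j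
    using mult_in_monomial_span[OF that[unfolded S_def]] unfolding S_def
    by (rule subsetD[OF monomial_span_mono, rotated]) (auto simp: l intro: add_mono)
  have S_mono: "S j \<subseteq> S i" if "i \<le> j" for i j
    unfolding S_def using that by (intro monomial_span_mono) auto
  have S_1: "1 \<in> S 0" by (simp add: S_def monomial_span_def)
  have f_pow: "f ^ j \<in> S (j * e)" for j
  proof (induction j)
    case (Suc j)
    moreover have "f \<in> S e" using e_le by (auto simp: S_def monomial_span_def)
    ultimately show ?case using S_mult[of f e "f ^ j" "j * e"] by simp
  qed (simp add: S_1)
  have "f \<in> monomial_span (Poly_Mapping.keys f)" by (simp add: monomial_span_def)
  from monomial_span_split[OF this, of "\<lambda>m. l m = e"] obtain g h where gh: "f = g + h" "g \<in> monomial_span (Poly_Mapping.keys f \<inter> {m. l m = e})"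
    "h \<in> monomial_span (Poly_Mapping.keys f \<inter> {m. l m \<noteq> e})"
    by blast
  have h: "h \<in> S (Suc e)" unfolding S_def
    by (rule subsetD[OF monomial_span_mono gh(3)]) (use e_le in \<open>fastforce simp: Suc_le_eq order_less_le\<close>)
  have "m1 \<notin> Poly_Mapping.keys h" using gh(3) m1 by (auto simp: monomial_span_def)
  then have "g \<noteq> 0" using gh(1) m1(1) by auto
  have l_0: "l 0 = 0" using l[of 0 0] by simp
  have g_pow: "g ^ j \<in> monomial_span {m. l m = j * e}" for j
  proof (induction j)
    case 0
    show ?case by (simp add: monomial_span_def l_0)
  next
    case (Suc j)
    show ?case unfolding power_Suc
      by (rule subsetD[OF monomial_span_mono mult_in_monomial_span[OF gh(2) Suc]]) (auto simp: l)
  qed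
  have fg: "f ^ j - g ^ j \<in> S (Suc (j * e))" for j
  proof (induction j)
    case (Suc j)
    have "f ^ Suc j - g ^ Suc j = f * (f ^ j - g ^ j) + h * g ^ j"
      by (simp add: gh(1) algebra_simps)
    moreover have "f * (f ^ j - g ^ j) \<in> S (Suc (Suc j * e))"
      using S_mult[of f e, OF _ Suc] f_pow[of 1] by simp
    moreover have "g ^ j \<in> S (j * e)" unfolding S_def
      by (rule subsetD[OF monomial_span_mono g_pow]) auto
    then have "h * g ^ j \<in> S (Suc (Suc j * e))"
      using S_mult[of h "Suc e"] h by simp
    ultimately show ?case unfolding S_def by (simp only: add_in_monomial_span)
  qed (simp add: S_def zero_in_monomial_span)
  have "c i * f ^ (k - i) \<in> S (Suc (k * e))" if i: "i \<in> {1..k}" for i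
  proof -
    have "c i * f ^ (k - i) \<in> S (d * i + (k - i) * e)"
      using S_mult f_pow c[OF i] by (simp add: S_def)
    \<comment> \<open>Relative to \<open>f ^ k\<close>, the coefficient replaces
      \<open>i \<ge> 1\<close> factors of weight at least \<open>e\<close> by weight at least
      \<open>d\<close> each; this gives the strict gain.\<close>
    moreover have "Suc (k * e) \<le> d * i + (k - i) * e"
    proof -
      have *: "k * e = i * e + (k - i) * e"
        using i by (simp flip: add_mult_distrib)
      have "i * e < d * i" using i \<open>e < d\<close> by (simp add: mult.commute)
      then have "i * e + (k - i) * e < d * i + (k - i) * e"
        by (rule add_strict_right_mono)
      then show ?thesis unfolding * by (rule Suc_leI)
    qed
    ultimately show ?thesis by (rule subsetD[OF S_mono, rotated])
  qed
  then have "- (\<Sum>i\<in>{1..k}. c i * f ^ (k - i)) \<in> S (Suc (k * e))"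
    unfolding S_def by (intro uminus_in_monomial_span sum_in_monomial_span)
  moreover have "f ^ k = - (\<Sum>i\<in>{1..k}. c i * f ^ (k - i))"
    using eq by (simp only: eq_neg_iff_add_eq_0)
  ultimately have "f ^ k \<in> S (Suc (k * e))" by (simp only:)
  then have "f ^ k + - (f ^ k - g ^ k) \<in> S (Suc (k * e))"
    using fg[of k] unfolding S_def by (intro add_in_monomial_span uminus_in_monomial_span)
  then have "g ^ k \<in> S (Suc (k * e))" by simp
  with g_pow[of k] have "Poly_Mapping.keys (g ^ k) = {}"
    by (fastforce simp: S_def monomial_span_def)
  \<comment> \<open>The linear order on the variables orders the exponents, and over a domain this
    excludes zero divisors among the polynomials; hence a power of \<open>g \<noteq> 0\<close>
    cannot vanish.\<close>
  then have "g ^ k = 0" by simp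
  with \<open>g \<noteq> 0\<close> show False by simp
qed

section \<open>Monomial ideals of the polynomial ring and their powers\<close>

lemma carrier_mpoly_ring: "carrier (mpoly_ring V) = monomial_span {m. Poly_Mapping.keys m \<subseteq> V}"
  by (auto simp: mpoly_ring_def monomial_span_def)

lemma mpoly_ring_simps [simp]:
  "p \<otimes>\<^bsub>mpoly_ring V\<^esub> q = p * q"
  "p \<oplus>\<^bsub>mpoly_ring V\<^esub> q = p + q"
  "\<one>\<^bsub>mpoly_ring V\<^esub> = 1"
  "\<zero>\<^bsub>mpoly_ring V\<^esub> = 0"
  by (simp_all add: mpoly_ring_def)

lemma mpoly_ring_pow [simp]: "p [^]\<^bsub>mpoly_ring V\<^esub> (n::nat) = p ^ n"
  by (induction n) (simp_all add: mult.commute)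

lemma mpoly_ring_finsum:
  assumes "finite A" "\<And>i. i \<in> A \<Longrightarrow> p i \<in> carrier (mpoly_ring V)"
  shows "(\<Oplus>\<^bsub>mpoly_ring V\<^esub>i\<in>A. p i) = (\<Sum>i\<in>A. p i)"
proof -
  interpret cring "mpoly_ring V" by (rule cring_mpoly_ring)
  show ?thesis
    using assms
  proof (induction A)
    case (insert i A)
    then have "p \<in> A \<rightarrow> carrier (mpoly_ring V)" "p i \<in> carrier (mpoly_ring V)"
      by (blast, blast)
    then show ?case
      using insert finsum_insert[of A i p] by simp
  qed simp
qed

definition exps_ideal :: "'v set \<Rightarrow> ('v \<Rightarrow>\<^sub>0 nat) set \<Rightarrow> bool" where
  "exps_ideal V E \<longleftrightarrow> E \<subseteq> {m. Poly_Mapping.keys m \<subseteq> V} \<and>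
    (\<forall>a\<in>E. \<forall>b. Poly_Mapping.keys b \<subseteq> V \<longrightarrow> a + b \<in> E)"

text \<open>The recursion starts with all exponents over \<open>V\<close> instead of the zero
  exponent alone, matching the convention that the zeroth power of an ideal is the whole
  ring.\<close>

fun sumset_pow :: "'v set \<Rightarrow> ('v \<Rightarrow>\<^sub>0 nat) set \<Rightarrow> nat \<Rightarrow> ('v \<Rightarrow>\<^sub>0 nat) set" where
  "sumset_pow V E 0 = {m. Poly_Mapping.keys m \<subseteq> V}"
| "sumset_pow V E (Suc t) = {a + b | a b. a \<in> sumset_pow V E t \<and> b \<in> E}"

lemma ideal_monomial_span:
  assumes "exps_ideal V E"
  shows "ideal (monomial_span E :: ('v, 'k::field) mpoly set) (mpoly_ring V)"
proof -
  let ?R = "mpoly_ring V :: ('v, 'k) mpoly ring"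
  interpret cring ?R by (rule cring_mpoly_ring)
  have closed: "p * q \<in> monomial_span E" if "p \<in> monomial_span E" "q \<in> carrier ?R" for p q :: "('v, 'k) mpoly"
    using mult_in_monomial_span[OF that[unfolded carrier_mpoly_ring]]
    by (rule subsetD[OF monomial_span_mono, rotated]) (use assms in \<open>auto simp: exps_ideal_def\<close>)
  have sub: "monomial_span E \<subseteq> carrier ?R"
    unfolding carrier_mpoly_ring using assms by (intro monomial_span_mono) (simp add: exps_ideal_def)
  show ?thesis
  proof (intro idealI subgroup.intro)
    fix p :: "('v, 'k) mpoly"
    assume p: "p \<in> monomial_span E"
    then have "- p \<in> monomial_span E" by (rule uminus_in_monomial_span)
    then have "p \<in> carrier ?R" "- p \<in> carrier ?R" using p sub by blast+
    then have "\<ominus>\<^bsub>?R\<^esub> p = - p" by (intro minus_equality) simp_all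
    with p show "inv\<^bsub>add_monoid ?R\<^esub> p \<in> monomial_span E"
      by (simp add: a_inv_def uminus_in_monomial_span)
  qed (use sub closed in \<open>auto simp: ring_axioms add_in_monomial_span zero_in_monomial_span mult.commute\<close>)
qed

lemma ideal_prod_monomial_span:
  fixes R :: "('v, 'k::field) mpoly ring"
  assumes R: "R = mpoly_ring V"
  shows "ideal_prod R (monomial_span E) (monomial_span F) = monomial_span {a + b | a b. a \<in> E \<and> b \<in> F}"
    (is "?P = monomial_span ?S")
proof (intro equalityI subsetI)
  fix p assume "p \<in> ?P"
  then show "p \<in> monomial_span ?S"
    by induction (simp_all only: R mpoly_ring_simps mult_in_monomial_span add_in_monomial_span)
next
  fix p :: "('v, 'k) mpoly"
  assume "p \<in> monomial_span ?S"
  then show "p \<in> ?P"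
  proof (induction rule: monomial_span_induct)
    case zero
    have "0 \<otimes>\<^bsub>R\<^esub> 0 \<in> ?P"
      by (intro ideal_prod.prod zero_in_monomial_span)
    then show ?case by (simp add: R)
  next
    case (single m c)
    then obtain a b where m: "m = a + b" "a \<in> E" "b \<in> F" by blast
    have "Poly_Mapping.single a 1 \<otimes>\<^bsub>R\<^esub> Poly_Mapping.single b c \<in> ?P"
      using m by (intro ideal_prod.prod single_in_monomial_span)
    then show ?case by (simp add: R m mult_single)
  next
    case (add p q)
    then show ?case using ideal_prod.sum[OF add] by (simp add: R)
  qed
qed

lemma ideal_pow_monomial_span:
  "ideal_pow (mpoly_ring V) (monomial_span E :: ('v, 'k::field) mpoly set) t = monomial_span (sumset_pow V E t)"
proof -
  interpret cring "mpoly_ring V :: ('v, 'k) mpoly ring" by (rule cring_mpoly_ring)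
  show ?thesis
  proof (induction t)
    case 0
    show ?case by (simp only: ideal_pow_0 carrier_mpoly_ring sumset_pow.simps)
  next
    case (Suc t)
    show ?case
      by (simp only: ideal_pow_Suc Suc ideal_prod_monomial_span[OF refl] sumset_pow.simps)
  qed
qed

text \<open>
  Throughout, \<open>\<Lambda>\<close> is a set of inequalities \<open>c t \<le> l(m)\<close> that cut out the exponents \<open>m\<close> of the
  monomials in the \<open>t\<close>-th power, simultaneously for all \<open>t\<close>.
\<close>

lemma normal_ideal_if_inequalities:
  fixes I :: "('v::linorder, 'k::field) mpoly set" and \<Lambda> :: "((('v \<Rightarrow>\<^sub>0 nat) \<Rightarrow> nat) \<times> nat) set"
  assumes I: "ideal I (mpoly_ring V)"
    and pow: "\<And>t. ideal_pow (mpoly_ring V) I t =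
      monomial_span {m. Poly_Mapping.keys m \<subseteq> V \<and> (\<forall>(l, c)\<in>\<Lambda>. c * t \<le> l m)}"
    and add: "\<And>l c a b. (l, c) \<in> \<Lambda> \<Longrightarrow> l (a + b) = l a + l b"
  shows "normal_ideal (mpoly_ring V) I"
proof -
  let ?R = "mpoly_ring V :: ('v, 'k) mpoly ring"
  interpret cring ?R by (rule cring_mpoly_ring)
  have "integral_closure ?R (ideal_pow ?R I t) \<subseteq> ideal_pow ?R I t" for t
  proof
    fix f assume "f \<in> integral_closure ?R (ideal_pow ?R I t)"
    then obtain k c where f: "f \<in> carrier ?R" and k: "k \<ge> 1"
      and c: "\<And>i. i \<in> {1..k} \<Longrightarrow> c i \<in> ideal_pow ?R (ideal_pow ?R I t) i"
      and eq: "f [^]\<^bsub>?R\<^esub> k \<oplus>\<^bsub>?R\<^esub> (\<Oplus>\<^bsub>?R\<^esub>i\<in>{1..k}. c i \<otimes>\<^bsub>?R\<^esub> f [^]\<^bsub>?R\<^esub> (k - i)) = \<zero>\<^bsub>?R\<^esub>"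
      unfolding integral_closure_def integral_over_def by blast
    have c': "c i \<in> ideal_pow ?R I (t * i)" if "i \<in> {1..k}" for i
      using c[OF that] unfolding ideal_pow_mult[OF I] .
    have "c i \<in> carrier ?R" if "i \<in> {1..k}" for i
      using ideal.Icarr[OF ideal_ideal_pow[OF I] c'[OF that]] .
    then have "(\<Oplus>\<^bsub>?R\<^esub>i\<in>{1..k}. c i \<otimes>\<^bsub>?R\<^esub> f [^]\<^bsub>?R\<^esub> (k - i)) =
        (\<Sum>i\<in>{1..k}. c i \<otimes>\<^bsub>?R\<^esub> f [^]\<^bsub>?R\<^esub> (k - i))"
      using f by (intro mpoly_ring_finsum m_closed nat_pow_closed) simp_all
    with eq have eq': "f ^ k + (\<Sum>i\<in>{1..k}. c i * f ^ (k - i)) = 0"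
      by (simp only: mpoly_ring_simps mpoly_ring_pow)
    \<comment> \<open>The threshold is \<open>d * t\<close>: the coefficient \<open>c i\<close> lies
      in the power of \<open>I\<close> with exponent \<open>t * i\<close>, so its terms have weight
      at least \<open>(d * t) * i\<close>.\<close>
    have "f \<in> monomial_span {m. d * t \<le> l m}" if "(l, d) \<in> \<Lambda>" for l d
    proof (rule integral_equation_weight[OF add[OF that] k _ eq'])
      fix i assume "i \<in> {1..k}"
      have "{m. Poly_Mapping.keys m \<subseteq> V \<and> (\<forall>(l, c)\<in>\<Lambda>. c * (t * i) \<le> l m)} \<subseteq> {m. d * t * i \<le> l m}"
        using that by (auto simp: mult.assoc)
      then show "c i \<in> monomial_span {m. d * t * i \<le> l m}"
        using c'[OF \<open>i \<in> {1..k}\<close>] monomial_span_mono unfolding pow by blast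
    qed
    with f show "f \<in> ideal_pow ?R I t"
      unfolding pow carrier_mpoly_ring monomial_span_def by blast
  qed
  then show ?thesis
    unfolding normal_ideal_def integrally_closed_def
    using subset_integral_closure[OF ideal_ideal_pow[OF I]] by blast
qed

text \<open>Multiplying by a monomial of \<open>I\<close> with \<open>l a = c\<close> raises the
  weight \<open>l\<close> by exactly \<open>c\<close>, so the inequality for \<open>k + 1\<close>
  falls back to the one for \<open>k\<close>. Each inequality may use its own monomial.\<close>

lemma strong_persistence_property_if_inequalities:
  fixes I :: "('v, 'k::field) mpoly set" and \<Lambda> :: "((('v \<Rightarrow>\<^sub>0 nat) \<Rightarrow> nat) \<times> nat) set"
  assumes I: "ideal I (mpoly_ring V)"
    and pow: "\<And>t. ideal_pow (mpoly_ring V) I t =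
      monomial_span {m. Poly_Mapping.keys m \<subseteq> V \<and> (\<forall>(l, c)\<in>\<Lambda>. c * t \<le> l m)}"
    and add: "\<And>l c a b. (l, c) \<in> \<Lambda> \<Longrightarrow> l (a + b) = l a + l b"
    and tight: "\<And>l c. (l, c) \<in> \<Lambda> \<Longrightarrow> \<exists>a. Poly_Mapping.single a 1 \<in> I \<and> l a = c"
  shows "strong_persistence_property (mpoly_ring V) I"
  unfolding strong_persistence_property_def
proof (intro allI impI equalityI subsetI)
  let ?R = "mpoly_ring V :: ('v, 'k) mpoly ring"
  interpret cring ?R by (rule cring_mpoly_ring)
  fix k :: nat and r :: "('v, 'k) mpoly"
  {
    assume r: "r \<in> colon_ideal ?R (ideal_pow ?R I (k + 1)) I"
    have "c * k \<le> l m" if lc: "(l, c) \<in> \<Lambda>" and m: "m \<in> Poly_Mapping.keys r" for l c m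
    proof -
      obtain a where a: "Poly_Mapping.single a 1 \<in> I" "l a = c"
        using tight[OF lc] by blast
      have "r * Poly_Mapping.single a 1 \<in> ideal_pow ?R I (k + 1)"
        using r a(1) by (simp only: colon_ideal_def mpoly_ring_simps) blast
      moreover have "m + a \<in> Poly_Mapping.keys (r * Poly_Mapping.single a 1)"
        using m by (simp add: in_keys_iff lookup_mult_single_add)
      ultimately have "c * (k + 1) \<le> l (m + a)"
        using lc unfolding pow monomial_span_def by blast
      then show ?thesis by (simp add: add[OF lc] a(2))
    qed
    moreover have "r \<in> carrier ?R"
      using r unfolding colon_ideal_def by blast
    ultimately show "r \<in> ideal_pow ?R I k"
      unfolding pow carrier_mpoly_ring by (auto simp: monomial_span_def)
  next
    assume r: "r \<in> ideal_pow ?R I k"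
    then have "r \<otimes>\<^bsub>?R\<^esub> a \<in> ideal_pow ?R I (k + 1)" if "a \<in> I" for a
      using that unfolding Suc_eq_plus1[symmetric] ideal_pow_Suc by (rule ideal_prod.prod)
    then show "r \<in> colon_ideal ?R (ideal_pow ?R I (k + 1)) I"
      using ideal.Icarr[OF ideal_ideal_pow[OF I] r] unfolding colon_ideal_def by blast
  }
qed

section \<open>Cover ideals\<close>

definition exps_of_set :: "'v set \<Rightarrow> ('v \<Rightarrow>\<^sub>0 nat)" where
  "exps_of_set W = (\<Sum>u\<in>W. Poly_Mapping.single u 1)"

lemma lookup_exps_of_set:
  "finite W \<Longrightarrow> Poly_Mapping.lookup (exps_of_set W) v = of_bool (v \<in> W)"
  by (simp add: exps_of_set_def lookup_sum lookup_single when_def)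

lemma keys_exps_of_set: "finite W \<Longrightarrow> Poly_Mapping.keys (exps_of_set W) = W"
  by (auto simp: in_keys_iff lookup_exps_of_set)

lemma prod_mvar: "(\<Prod>u\<in>W. mvar u) = Poly_Mapping.single (exps_of_set W) (1::'k::field)"
  by (induction W rule: infinite_finite_induct)
    (simp_all add: exps_of_set_def mvar_def mult_single)

definition cover_exps :: "'v ugraph \<Rightarrow> ('v \<Rightarrow>\<^sub>0 nat) set" where
  "cover_exps G = {m. Poly_Mapping.keys m \<subseteq> vertices G \<and> vertex_cover G (Poly_Mapping.keys m)}"

lemma vertex_cover_mono:
  "vertex_cover G W \<Longrightarrow> W \<subseteq> W' \<Longrightarrow> W' \<subseteq> vertices G \<Longrightarrow> vertex_cover G W'"
  unfolding vertex_cover_def by blast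

lemma ex_minimal_vertex_cover:
  assumes "finite W" "vertex_cover G W"
  shows "\<exists>W'\<subseteq>W. minimal_vertex_cover G W'"
  using assms
proof (induction W rule: finite_psubset_induct)
  case (psubset W)
  show ?case
  proof (cases "minimal_vertex_cover G W")
    case False
    then obtain W' where "W' \<subset> W" "vertex_cover G W'"
      using psubset.prems unfolding minimal_vertex_cover_def by blast
    with psubset.IH[of W'] show ?thesis by blast
  qed blast
qed

lemma exps_ideal_cover_exps: "exps_ideal (vertices G) (cover_exps G)"
proof -
  have "a + b \<in> cover_exps G" if "a \<in> cover_exps G" "Poly_Mapping.keys b \<subseteq> vertices G" for a b
  proof -
    have "Poly_Mapping.keys a \<subseteq> Poly_Mapping.keys (a + b)"
      by (auto simp: in_keys_iff lookup_add)
    moreover have "Poly_Mapping.keys (a + b) \<subseteq> vertices G"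
      using that keys_add[of a b] unfolding cover_exps_def by blast
    ultimately show ?thesis
      using that vertex_cover_mono unfolding cover_exps_def by blast
  qed
  then show ?thesis unfolding exps_ideal_def cover_exps_def by blast
qed

text \<open>Every finite cover contains a minimal one, so a monomial whose support is a cover is
  divisible by one of the generators.\<close>

lemma cover_ideal_eq_monomial_span:
  assumes fin: "finite (vertices G)"
  shows "(cover_ideal G :: ('v, 'k::field) mpoly set) = monomial_span (cover_exps G)"
proof -
  let ?R = "mpoly_ring (vertices G) :: ('v, 'k) mpoly ring"
  let ?A = "{(\<Prod>u\<in>W. mvar u) | W. minimal_vertex_cover G W} :: ('v, 'k) mpoly set"
  interpret cring ?R by (rule cring_mpoly_ring)
  interpret E: ideal "monomial_span (cover_exps G) :: ('v, 'k) mpoly set" ?R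
    by (rule ideal_monomial_span[OF exps_ideal_cover_exps])
  have finW: "finite W" if "vertex_cover G W" for W
    using that fin finite_subset unfolding vertex_cover_def by blast
  have A: "?A \<subseteq> monomial_span (cover_exps G)"
  proof (clarsimp simp: prod_mvar)
    fix W assume "minimal_vertex_cover G W"
    then have W: "vertex_cover G W" unfolding minimal_vertex_cover_def by blast
    then have "exps_of_set W \<in> cover_exps G"
      by (simp add: cover_exps_def keys_exps_of_set[OF finW[OF W]]) (simp add: vertex_cover_def)
    then show "Poly_Mapping.single (exps_of_set W) 1 \<in> monomial_span (cover_exps G)"
      by (rule single_in_monomial_span)
  qed
  then have A_R: "?A \<subseteq> carrier ?R" using E.a_subset by (rule order_trans)
  interpret I: ideal "cover_ideal G :: ('v, 'k) mpoly set" ?R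
    unfolding cover_ideal_def by (rule genideal_ideal[OF A_R])
  show ?thesis
  proof (intro equalityI subsetI)
    fix p :: "('v, 'k) mpoly" assume "p \<in> cover_ideal G"
    then show "p \<in> monomial_span (cover_exps G)"
      using genideal_minimal[OF E.ideal_axioms A] unfolding cover_ideal_def by blast
  next
    fix p :: "('v, 'k) mpoly" assume "p \<in> monomial_span (cover_exps G)"
    then show "p \<in> cover_ideal G"
    proof (induction rule: monomial_span_induct)
      case zero
      show ?case using I.zero_closed by (simp only: mpoly_ring_simps)
    next
      case (add p q)
      then show ?case using I.a_closed[OF add] by (simp only: mpoly_ring_simps)
    next
      case (single m c)
      then have m: "Poly_Mapping.keys m \<subseteq> vertices G" "vertex_cover G (Poly_Mapping.keys m)"
        unfolding cover_exps_def by blast+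
      obtain W where W: "W \<subseteq> Poly_Mapping.keys m" "minimal_vertex_cover G W"
        using ex_minimal_vertex_cover[OF finite_keys m(2)] by blast
      then have finW: "finite W" using finite_subset[OF W(1)] by simp
      have gen: "(\<Prod>u\<in>W. mvar u) \<in> (cover_ideal G :: ('v, 'k) mpoly set)"
        using W(2) genideal_self[OF A_R] unfolding cover_ideal_def by blast
      \<comment> \<open>Subtraction of exponents is truncated; it is exact here because
        \<open>W\<close> lies in the support of \<open>m\<close>.\<close>
      have "exps_of_set W + (m - exps_of_set W) = m"
      proof (rule poly_mapping_eqI)
        fix v
        show "Poly_Mapping.lookup (exps_of_set W + (m - exps_of_set W)) v = Poly_Mapping.lookup m v"
          using W(1) by (auto simp: lookup_add lookup_minus lookup_exps_of_set[OF finW] in_keys_iff Suc_le_eq subset_iff)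
      qed
      moreover have "Poly_Mapping.keys (m - exps_of_set W) \<subseteq> Poly_Mapping.keys m"
        by (auto simp: in_keys_iff lookup_minus)
      then have "Poly_Mapping.single (m - exps_of_set W) c \<in> carrier ?R"
        using m(1) unfolding carrier_mpoly_ring by (intro single_in_monomial_span) blast
      from I.I_r_closed[OF gen this]
      have "Poly_Mapping.single (exps_of_set W + (m - exps_of_set W)) c \<in> (cover_ideal G :: ('v, 'k) mpoly set)"
        by (simp only: prod_mvar mpoly_ring_simps mult_single mult_1)
      ultimately show ?case by (simp only:)
    qed
  qed
qed

text \<open>The covers are split off one at a time. Whatever remains of \<open>m\<close> after the
  last one is absorbed by the zeroth sumset, so upper bounds on the multiplicities suffice.\<close>

lemma sumset_pow_covers:
  assumes fin: "finite (vertices G)"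
    and W: "\<And>i. i < t \<Longrightarrow> vertex_cover G (W i)"
    and m: "Poly_Mapping.keys m \<subseteq> vertices G"
    and count: "\<And>v. v \<in> vertices G \<Longrightarrow> card {i. i < t \<and> v \<in> W i} \<le> Poly_Mapping.lookup m v"
  shows "m \<in> sumset_pow (vertices G) (cover_exps G) t"
  using W m count
proof (induction t arbitrary: m)
  case (Suc t)
  have Wt: "vertex_cover G (W t)" by (rule Suc.prems) simp
  then have Wt_sub: "W t \<subseteq> vertices G" unfolding vertex_cover_def by blast
  then have finW: "finite (W t)" using fin finite_subset by blast
  let ?e = "exps_of_set (W t)"
  have cardSuc: "card {i. i < Suc t \<and> v \<in> W i} = card {i. i < t \<and> v \<in> W i} + of_bool (v \<in> W t)" for v
  proof -
    have "{i. i < Suc t \<and> v \<in> W i} = {i. i < t \<and> v \<in> W i} \<union> (if v \<in> W t then {t} else {})"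
      by (auto simp: less_Suc_eq)
    then show ?thesis by simp
  qed
  have "m - ?e + ?e = m"
  proof (rule poly_mapping_eqI)
    fix v
    show "Poly_Mapping.lookup (m - ?e + ?e) v = Poly_Mapping.lookup m v"
    proof (cases "v \<in> W t")
      case True
      then have "1 \<le> Poly_Mapping.lookup m v"
        using Suc.prems(3)[of v] Wt_sub cardSuc[of v] by auto
      then show ?thesis using True by (simp add: lookup_add lookup_minus lookup_exps_of_set[OF finW])
    qed (simp add: lookup_add lookup_minus lookup_exps_of_set[OF finW])
  qed
  moreover have "?e \<in> cover_exps G"
    using Wt Wt_sub by (simp add: cover_exps_def keys_exps_of_set[OF finW])
  moreover have "m - ?e \<in> sumset_pow (vertices G) (cover_exps G) t"
  proof (rule Suc.IH)
    show "vertex_cover G (W i)" if "i < t" for i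
      using that by (intro Suc.prems) simp
    have "Poly_Mapping.keys (m - ?e) \<subseteq> Poly_Mapping.keys m"
      by (auto simp: in_keys_iff lookup_minus)
    then show "Poly_Mapping.keys (m - ?e) \<subseteq> vertices G"
      using Suc.prems(2) by (rule order_trans)
    show "card {i. i < t \<and> v \<in> W i} \<le> Poly_Mapping.lookup (m - ?e) v" if "v \<in> vertices G" for v
      using Suc.prems(3)[OF that] cardSuc[of v] by (simp add: lookup_minus lookup_exps_of_set[OF finW])
  qed
  ultimately show ?case by (metis (mono_tags, lifting) CollectI sumset_pow.simps(2))
qed simp

lemma sumset_pow_weight:
  assumes l: "\<And>a b. l (a + b) = l a + (l b :: nat)"
    and E: "\<And>a. a \<in> E \<Longrightarrow> c \<le> l a"
    and m: "m \<in> sumset_pow V E t"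
  shows "c * t \<le> l m"
  using m
proof (induction t arbitrary: m)
  case (Suc t)
  then obtain a b where "m = a + b" "a \<in> sumset_pow V E t" "b \<in> E" by auto
  with Suc.IH[of a] E[of b] show ?case by (simp add: l)
qed simp

section \<open>The helm graph\<close>

lemma sumset_pow_keys:
  assumes "E \<subseteq> {m. Poly_Mapping.keys m \<subseteq> V}" "m \<in> sumset_pow V E t"
  shows "Poly_Mapping.keys m \<subseteq> V"
  using assms(2)
proof (induction t arbitrary: m)
  case (Suc t)
  then obtain a b where "m = a + b" "Poly_Mapping.keys a \<subseteq> V" "b \<in> E" by auto
  with assms(1) keys_add[of a b] show ?case by blast
qed simp

lemma ball_cycle_edges:
  "(\<forall>e\<in>cycle_edges (2 * n + 1). Q e) \<longleftrightarrow> (\<forall>i\<in>{1..2 * n}. Q {i, i + 1}) \<and> Q {2 * n + 1, 1}"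
proof -
  have "{{i, i + 1} | i. 1 \<le> i \<and> i < 2 * n + 1} = (\<lambda>i. {i, i + 1}) ` {1..2 * n}"
    by auto
  then show ?thesis
    unfolding cycle_edges_def by (simp only: ball_Un Set.ball_simps) simp
qed

lemma edges_helm_graph:
  "edges (helm_graph (2 * n + 1)) = cycle_edges (2 * n + 1) \<union>
    ((\<lambda>i. {2 * n + 2, i}) ` {1..2 * n + 1} \<union> (\<lambda>i. {i, 2 * n + 2 + i}) ` {1..2 * n + 1})"
proof -
  have "{f i | i. 1 \<le> i \<and> i \<le> 2 * n + 1} = f ` {1..2 * n + 1}" for f :: "nat \<Rightarrow> nat set"
    by auto
  then show ?thesis
    by (simp add: helm_graph_def wheel_graph_def Un_assoc)
qed

lemma ball_edges_helm_graph:
  "(\<forall>e\<in>edges (helm_graph (2 * n + 1)). Q e) \<longleftrightarrow>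
    ((\<forall>i\<in>{1..2 * n}. Q {i, i + 1}) \<and> Q {2 * n + 1, 1}) \<and>
    (\<forall>i\<in>{1..2 * n + 1}. Q {2 * n + 2, i}) \<and> (\<forall>i\<in>{1..2 * n + 1}. Q {i, 2 * n + 2 + i})"
  unfolding edges_helm_graph ball_Un ball_cycle_edges by (simp only: Set.ball_simps)

lemma vertex_cover_helm_graph:
  "vertex_cover (helm_graph (2 * n + 1)) W \<longleftrightarrow> W \<subseteq> {1..4 * n + 3} \<and>
    ((\<forall>i\<in>{1..2 * n}. i \<in> W \<or> i + 1 \<in> W) \<and> (2 * n + 1 \<in> W \<or> 1 \<in> W)) \<and>
    (\<forall>i\<in>{1..2 * n + 1}. 2 * n + 2 \<in> W \<or> i \<in> W) \<and>
    (\<forall>i\<in>{1..2 * n + 1}. i \<in> W \<or> 2 * n + 2 + i \<in> W)"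
proof -
  have "W \<inter> {u, v} \<noteq> {} \<longleftrightarrow> u \<in> W \<or> v \<in> W" for u v by blast
  moreover have "vertices (helm_graph (2 * n + 1)) = {1..4 * n + 3}"
    unfolding vertices_helm_graph by simp
  ultimately show ?thesis
    unfolding vertex_cover_def ball_edges_helm_graph by (simp only:)
qed

section \<open>The inequalities of the helm graph\<close>

definition exps_sum :: "'v set \<Rightarrow> ('v \<Rightarrow>\<^sub>0 nat) \<Rightarrow> nat" where
  "exps_sum A m = (\<Sum>v\<in>A. Poly_Mapping.lookup m v)"

lemma exps_sum_add: "exps_sum A (a + b) = exps_sum A a + exps_sum A b"
  by (simp add: exps_sum_def lookup_add sum.distrib)

text \<open>Write b_i = t - x_i for the demand of a cycle vertex and h for the hub. The triangles
  express b_i + b_j \<le> x_h along a cycle edge. An independent set of the cycle has at most n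
  vertices, so the demands sum to at most n times the number of available colours: the bound n t
  yields the constant \<open>n + 1\<close>, the bound n x_h the constant
  \<open>2 * n + 1\<close>.\<close>

definition helm_inequalities :: "nat \<Rightarrow> (((nat \<Rightarrow>\<^sub>0 nat) \<Rightarrow> nat) \<times> nat) set" where
  "helm_inequalities n =
    (\<lambda>e. (exps_sum e, 1)) ` edges (helm_graph (2 * n + 1)) \<union>
    (\<lambda>e. (exps_sum (insert (2 * n + 2) e), 2)) ` cycle_edges (2 * n + 1) \<union>
    {(exps_sum {1..2 * n + 1}, n + 1),
     (\<lambda>m. exps_sum {1..2 * n + 1} m + n * Poly_Mapping.lookup m (2 * n + 2), 2 * n + 1)}"

lemma helm_inequalities_add:
  "(l, c) \<in> helm_inequalities n \<Longrightarrow> l (a + b) = l a + l b"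
  by (auto simp: helm_inequalities_def exps_sum_add lookup_add add_mult_distrib2)

lemma helm_inequalities_iff:
  fixes m :: "nat \<Rightarrow>\<^sub>0 nat"
  assumes "n \<ge> 1"
  defines "x \<equiv> Poly_Mapping.lookup m"
  shows "(\<forall>(l, c)\<in>helm_inequalities n. c * t \<le> l m) \<longleftrightarrow>
    (((\<forall>i\<in>{1..2*n}. t \<le> x i + x (i + 1)) \<and> t \<le> x (2 * n + 1) + x 1) \<and>
     (\<forall>i\<in>{1..2*n+1}. t \<le> x (2 * n + 2) + x i) \<and> (\<forall>i\<in>{1..2*n+1}. t \<le> x i + x (2 * n + 2 + i))) \<and>
    ((\<forall>i\<in>{1..2*n}. 2 * t \<le> x (2 * n + 2) + x i + x (i + 1)) \<and>
     2 * t \<le> x (2 * n + 2) + x (2 * n + 1) + x 1) \<and>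
    (n + 1) * t \<le> (\<Sum>i=1..2*n+1. x i) \<and> (2 * n + 1) * t \<le> (\<Sum>i=1..2*n+1. x i) + n * x (2 * n + 2)"
proof -
  have split: "(\<forall>(l, c)\<in>helm_inequalities n. c * t \<le> l m) \<longleftrightarrow>
    (\<forall>e\<in>edges (helm_graph (2 * n + 1)). t \<le> exps_sum e m) \<and>
    (\<forall>e\<in>cycle_edges (2 * n + 1). 2 * t \<le> exps_sum (insert (2 * n + 2) e) m) \<and>
    (n + 1) * t \<le> exps_sum {1..2*n+1} m \<and> (2 * n + 1) * t \<le> exps_sum {1..2*n+1} m + n * x (2 * n + 2)"
    unfolding helm_inequalities_def ball_Un
    by (simp only: Set.ball_simps prod.case mult_1 x_def simp_thms conj_assoc)
  have edge: "exps_sum {u, v} m = x u + x v" if "u \<noteq> v" for u v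
    using that by (simp add: exps_sum_def x_def)
  have triangle: "exps_sum {w, u, v} m = x w + x u + x v" if "u \<noteq> v" "w \<noteq> u" "w \<noteq> v" for w u v
    using that by (simp add: exps_sum_def x_def)
  have cycle: "exps_sum {1..2*n+1} m = (\<Sum>i=1..2*n+1. x i)"
    by (simp add: exps_sum_def x_def)
  show ?thesis
    unfolding split ball_edges_helm_graph ball_cycle_edges cycle
    \<comment> \<open>\<open>n \<ge> 1\<close> keeps the ends of the closing edge distinct;
      otherwise the sum over that edge, a set, would count its only vertex once.\<close>
    using assms(1) by (intro conj_cong ball_cong refl) (simp_all add: edge triangle)
qed

text \<open>Since the weights are additive, necessity for all \<open>t\<close> follows from this
  case of a single cover. The cycle vertices missed by a cover, marked by \<open>b\<close>, are
  independent and hence at most \<open>n\<close>; a cover without the hub contains the whole cycle;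
  and a cover takes two vertices of every triangle.\<close>

lemma helm_cover_inequalities:
  assumes n: "n \<ge> 1" and W: "vertex_cover (helm_graph (2 * n + 1)) (Poly_Mapping.keys a)"
  shows "\<forall>(l, c)\<in>helm_inequalities n. c * 1 \<le> l a"
proof -
  define x where "x = Poly_Mapping.lookup a"
  have pos: "i \<in> Poly_Mapping.keys a \<longleftrightarrow> 0 < x i" for i by (simp add: x_def in_keys_iff)
  note cover = conjunct2[OF W[unfolded vertex_cover_helm_graph pos]]
  note e1 = bspec[OF conjunct1[OF conjunct1[OF cover]]] and e2 = conjunct2[OF conjunct1[OF cover]]
    and e3 = bspec[OF conjunct1[OF conjunct2[OF cover]]]
    and e4 = bspec[OF conjunct2[OF conjunct2[OF cover]]]
  define b :: "nat \<Rightarrow> nat" where "b i = of_bool (x i = 0)" for i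
  have "\<exists>j. 1 \<le> j \<and> j \<le> 2 * n + 1 \<and> b j = 0"
  proof (cases "0 < x 1")
    case True
    then show ?thesis by (intro exI[of _ 1]) (simp add: b_def)
  next
    case False
    then have "0 < x (2 * n + 1)" using e2 by simp
    then show ?thesis by (intro exI[of _ "2 * n + 1"]) (simp add: b_def)
  qed
  then obtain j where j: "1 \<le> j" "j \<le> 2 * n + 1" "b j = 0" by blast
  have "b i + b (i + 1) \<le> 1" if "1 \<le> i" "i \<le> 2 * n" for i
    using e1[of i] that by (auto simp: b_def)
  moreover have "b (2 * n + 1) + b 1 \<le> 1"
    using e2 by (auto simp: b_def)
  ultimately have "(\<Sum>i=1..2*n+1. b i) \<le> n * 1"
    by (rule odd_cycle_sum_le_if_zero) (use j in simp_all)
  moreover have "(\<Sum>i=1..2*n+1. 1) \<le> (\<Sum>i=1..2*n+1. x i + b i)"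
    by (intro sum_mono) (simp add: b_def)
  then have "2 * n + 1 \<le> (\<Sum>i=1..2*n+1. x i) + (\<Sum>i=1..2*n+1. b i)"
    by (simp add: sum.distrib)
  ultimately have c1: "n + 1 \<le> (\<Sum>i=1..2*n+1. x i)" by linarith
  have c2: "2 * n + 1 \<le> (\<Sum>i=1..2*n+1. x i) + n * x (2 * n + 2)"
  proof (cases "0 < x (2 * n + 2)")
    case True
    then have "n * 1 \<le> n * x (2 * n + 2)" by (intro mult_le_mono2) simp
    then show ?thesis using c1 by linarith
  next
    case False
    then have "(\<Sum>i=1..2*n+1. 1) \<le> (\<Sum>i=1..2*n+1. x i)"
      using e3 by (intro sum_mono) (simp add: Suc_le_eq)
    then show ?thesis by simp
  qed
  have t1: "\<forall>i\<in>{1..2*n}. 2 \<le> x (2 * n + 2) + x i + x (i + 1)"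
  proof
    fix i assume i: "i \<in> {1..2*n}"
    then have "i \<in> {1..2*n+1}" "i + 1 \<in> {1..2*n+1}" by auto
    from e1[OF i] this[THEN e3] show "2 \<le> x (2 * n + 2) + x i + x (i + 1)" by linarith
  qed
  have t2: "2 \<le> x (2 * n + 2) + x (2 * n + 1) + x 1"
  proof -
    have "2 * n + 1 \<in> {1..2*n+1}" "1 \<in> {1..2*n+1}" by auto
    from e2 this[THEN e3] show ?thesis by linarith
  qed
  have pos2: "1 \<le> p + q \<longleftrightarrow> 0 < p \<or> 0 < q" for p q :: nat by linarith
  show ?thesis
    unfolding helm_inequalities_iff[OF n]
    unfolding x_def[symmetric] mult_1_right pos2
    using cover t1 t2 c1 c2 by (intro conjI) (elim conjE; assumption)+
qed

text \<open>
  A family of \<open>t\<close> covers using each vertex \<open>v\<close> at most \<open>x v\<close> times is, by complementation, a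
  colouring with \<open>t\<close> colours in which \<open>v\<close> receives at least \<open>t - x v\<close> of them. The hub takes the
  last \<open>t - x h\<close> colours, which leaves \<open>s = min (x h) t\<close> for the cycle.
\<close>

lemma helm_covers_exist:
  fixes x :: "nat \<Rightarrow> nat"
  assumes e1: "\<forall>i\<in>{1..2*n}. t \<le> x i + x (i + 1)" and e2: "t \<le> x (2 * n + 1) + x 1"
    and e3: "\<forall>i\<in>{1..2*n+1}. t \<le> x (2 * n + 2) + x i"
    and e4: "\<forall>i\<in>{1..2*n+1}. t \<le> x i + x (2 * n + 2 + i)"
    and t1: "\<forall>i\<in>{1..2*n}. 2 * t \<le> x (2 * n + 2) + x i + x (i + 1)"
    and t2: "2 * t \<le> x (2 * n + 2) + x (2 * n + 1) + x 1"
    and c1: "(n + 1) * t \<le> (\<Sum>i=1..2*n+1. x i)"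
    and c2: "(2 * n + 1) * t \<le> (\<Sum>i=1..2*n+1. x i) + n * x (2 * n + 2)"
  shows "\<exists>W. (\<forall>c<t. vertex_cover (helm_graph (2 * n + 1)) (W c)) \<and>
    (\<forall>v\<in>{1..4*n+3}. card {c. c < t \<and> v \<in> W c} \<le> x v)"
proof -
  define h where "h = 2 * n + 2"
  define s where "s = min (x h) t"
  define b where "b i = t - x i" for i
  \<comment> \<open>If both demands are positive, the bounds by \<open>t\<close> and by
    \<open>x h\<close> are \<open>e1\<close> and \<open>t1\<close>; if only one is, the bound by
    \<open>x h\<close> is \<open>e3\<close>.\<close>
  have path: "b i + b (i + 1) \<le> s" if "1 \<le> i" "i \<le> 2 * n" for i
  proof -
    have "i \<in> {1..2*n}" "i \<in> {1..2*n+1}" "i + 1 \<in> {1..2*n+1}" using that by auto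
    then have "t \<le> x i + x (i + 1)" "t \<le> x h + x i" "t \<le> x h + x (i + 1)"
      "2 * t \<le> x h + x i + x (i + 1)"
      using e1 e3 t1 unfolding h_def by blast+
    then show ?thesis unfolding s_def b_def by linarith
  qed
  have ends: "b (2 * n + 1) + b 1 \<le> s"
  proof -
    have "2 * n + 1 \<in> {1..2*n+1}" "1 \<in> {1..2*n+1}" by auto
    then have "t \<le> x h + x (2 * n + 1)" "t \<le> x h + x 1"
      using e3 unfolding h_def by blast+
    then show ?thesis using e2 t2 unfolding s_def b_def h_def by linarith
  qed
  have total: "(\<Sum>i=1..2*n+1. b i) \<le> n * s"
  \<comment> \<open>Only without a zero demand is \<open>b i + x i = t\<close> exact all around the
    cycle, which is what allows \<open>c1\<close> and \<open>c2\<close> to be rewritten as bounds on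
    the demands.\<close>
  proof (cases "\<exists>j. 1 \<le> j \<and> j \<le> 2 * n + 1 \<and> b j = 0")
    case True
    then obtain j where "1 \<le> j" "j \<le> 2 * n + 1" "b j = 0" by blast
    with path ends show ?thesis by (intro odd_cycle_sum_le_if_zero)
  next
    case False
    have "(\<Sum>i=1..2*n+1. b i + x i) = (\<Sum>i=1..2*n+1. t)"
    proof (intro sum.cong refl)
      fix i assume "i \<in> {1..2*n+1}"
      then have "b i \<noteq> 0" using False by auto
      then show "b i + x i = t" unfolding b_def by simp
    qed
    also have "\<dots> = (2 * n + 1) * t" by simp
    finally have "(\<Sum>i=1..2*n+1. b i) + (\<Sum>i=1..2*n+1. x i) = (2 * n + 1) * t"
      by (simp only: sum.distrib)
    moreover have "(2 * n + 1) * t = n * t + (n + 1) * t" by (simp add: algebra_simps)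
    ultimately have "(\<Sum>i=1..2*n+1. b i) \<le> n * t" "(\<Sum>i=1..2*n+1. b i) \<le> n * x h"
      using c1 c2 unfolding h_def by linarith+
    then show ?thesis unfolding s_def by (simp only: min_def split: if_split) simp
  qed
  have "\<exists>B. (\<forall>i\<in>{1..2*n+1}. B i \<subseteq> {..<s} \<and> card (B i) = b i) \<and>
      (\<forall>i\<in>{1..2*n}. B i \<inter> B (i + 1) = {}) \<and> B (2 * n + 1) \<inter> B 1 = {}"
    using path ends total by (intro odd_cycle_multicolouring)
  then obtain B where B: "\<forall>i\<in>{1..2*n+1}. B i \<subseteq> {..<s} \<and> card (B i) = b i"
    and B_path: "\<forall>i\<in>{1..2*n}. B i \<inter> B (i + 1) = {}" and B_ends: "B (2 * n + 1) \<inter> B 1 = {}"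
    by (elim exE conjE)
  \<comment> \<open>A pendant vertex joins the cover exactly when its neighbour is missing, hence
    \<open>b i\<close> times in all. For \<open>c \<ge> s\<close> the hub is missing, and then every
    cycle vertex is present because cycle colours lie below \<open>s\<close>.\<close>
  define W where "W c = {i \<in> {1..2*n+1}. c \<notin> B i} \<union> {v. v = h \<and> c < s} \<union>
    {h + i | i. i \<in> {1..2*n+1} \<and> c \<in> B i}" for c
  have W_cycle: "i \<in> W c \<longleftrightarrow> c \<notin> B i" if "i \<in> {1..2*n+1}" for i c
    using that unfolding W_def h_def by auto
  have W_hub: "h \<in> W c \<longleftrightarrow> c < s" for c
    unfolding W_def h_def by auto
  have W_pendant: "h + i \<in> W c \<longleftrightarrow> c \<in> B i" if "i \<in> {1..2*n+1}" for i c
    using that unfolding W_def h_def by auto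
  have "vertex_cover (helm_graph (2 * n + 1)) (W c)" for c
    unfolding vertex_cover_helm_graph h_def[symmetric]
  proof (intro conjI ballI)
    show "W c \<subseteq> {1..4*n+3}" unfolding W_def h_def by auto
    show "i \<in> W c \<or> i + 1 \<in> W c" if i: "i \<in> {1..2*n}" for i
      using B_path i W_cycle[of i c] W_cycle[of "i + 1" c] by auto
    show "2 * n + 1 \<in> W c \<or> 1 \<in> W c"
      using B_ends W_cycle[of "2 * n + 1" c] W_cycle[of 1 c] by auto
    show "h \<in> W c \<or> i \<in> W c" if i: "i \<in> {1..2*n+1}" for i
      using W_hub W_cycle[OF i] bspec[OF B i] by auto
    show "i \<in> W c \<or> h + i \<in> W c" if i: "i \<in> {1..2*n+1}" for i
      using W_cycle[OF i] W_pendant[OF i] by blast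
  qed
  moreover have "card {c. c < t \<and> v \<in> W c} \<le> x v" if v: "v \<in> {1..4*n+3}" for v
  proof -
    have "s \<le> t" unfolding s_def by simp
    consider "v \<in> {1..2*n+1}" | "v = h" | i where "v = h + i" "i \<in> {1..2*n+1}"
    proof -
      have "v \<in> {1..2*n+1} \<or> v = h \<or> (v = h + (v - h) \<and> v - h \<in> {1..2*n+1})"
        using v unfolding h_def by auto
      then show ?thesis using that by blast
    qed
    then show ?thesis
    proof cases
      case 1
      have Bv: "B v \<subseteq> {..<s}" "card (B v) = b v" using bspec[OF B 1] by blast+
      have "{c. c < t \<and> v \<in> W c} = {..<t} - B v"
        unfolding W_cycle[OF 1] by auto
      moreover have "B v \<subseteq> {..<t}" using Bv(1) \<open>s \<le> t\<close> by auto
      ultimately have "card {c. c < t \<and> v \<in> W c} = t - b v"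
        using Bv(2) finite_subset[OF Bv(1)] by (simp add: card_Diff_subset)
      then show ?thesis unfolding b_def by simp
    next
      case 2
      have "{c. c < t \<and> v \<in> W c} = {..<s}"
        unfolding 2 W_hub using \<open>s \<le> t\<close> by auto
      then show ?thesis unfolding 2 s_def by simp
    next
      case (3 i)
      have Bi: "B i \<subseteq> {..<s}" "card (B i) = b i" using bspec[OF B 3(2)] by blast+
      have "{c. c < t \<and> v \<in> W c} = B i"
        unfolding 3(1) W_pendant[OF 3(2)] using Bi(1) \<open>s \<le> t\<close> by auto
      moreover have "t \<le> x i + x (h + i)" using e4 3(2) unfolding h_def by blast
      ultimately show ?thesis using Bi(2) unfolding 3(1) b_def by simp
    qed
  qed
  ultimately show ?thesis by blast
qed

lemma sumset_pow_helm_graph: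
  fixes n :: nat
  assumes n: "n \<ge> 1"
  defines "G \<equiv> helm_graph (2 * n + 1)"
  shows "sumset_pow (vertices G) (cover_exps G) t =
    {m. Poly_Mapping.keys m \<subseteq> vertices G \<and> (\<forall>(l, c)\<in>helm_inequalities n. c * t \<le> l m)}"
proof (intro equalityI subsetI)
  fix m assume m: "m \<in> sumset_pow (vertices G) (cover_exps G) t"
  have "c * t \<le> l m" if "(l, c) \<in> helm_inequalities n" for l c
  proof (rule sumset_pow_weight[OF helm_inequalities_add[OF that] _ m])
    fix a assume "a \<in> cover_exps G"
    then have "vertex_cover (helm_graph (2 * n + 1)) (Poly_Mapping.keys a)"
      unfolding cover_exps_def G_def by blast
    from helm_cover_inequalities[OF n this] that show "c \<le> l a" by auto
  qed
  moreover have "Poly_Mapping.keys m \<subseteq> vertices G"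
    by (rule sumset_pow_keys[OF _ m]) (auto simp: cover_exps_def)
  ultimately show "m \<in> {m. Poly_Mapping.keys m \<subseteq> vertices G \<and> (\<forall>(l, c)\<in>helm_inequalities n. c * t \<le> l m)}"
    by blast
next
  fix m assume "m \<in> {m. Poly_Mapping.keys m \<subseteq> vertices G \<and> (\<forall>(l, c)\<in>helm_inequalities n. c * t \<le> l m)}"
  then have keys: "Poly_Mapping.keys m \<subseteq> vertices G"
    and ineqs: "\<forall>(l, c)\<in>helm_inequalities n. c * t \<le> l m" by blast+
  have V: "vertices G = {1..4 * n + 3}"
    unfolding G_def vertices_helm_graph by simp
  have "\<exists>W. (\<forall>c<t. vertex_cover (helm_graph (2 * n + 1)) (W c)) \<and>
    (\<forall>v\<in>{1..4*n+3}. card {c. c < t \<and> v \<in> W c} \<le> Poly_Mapping.lookup m v)"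
    using ineqs[unfolded helm_inequalities_iff[OF n]]
    by (elim conjE) (rule helm_covers_exist; assumption)
  then obtain W where
    "\<forall>c<t. vertex_cover (helm_graph (2 * n + 1)) (W c)"
    "\<forall>v\<in>{1..4*n+3}. card {c. c < t \<and> v \<in> W c} \<le> Poly_Mapping.lookup m v"
    by (elim exE conjE)
  then show "m \<in> sumset_pow (vertices G) (cover_exps G) t"
    using keys unfolding G_def[symmetric] V[symmetric]
    by (intro sumset_pow_covers[of G t W]) (simp_all add: V)
qed

section \<open>Vertex covers at which the inequalities are tight\<close>

lemma exps_sum_exps_of_set:
  "finite W \<Longrightarrow> finite A \<Longrightarrow> exps_sum A (exps_of_set W) = card (A \<inter> W)"
  by (simp add: exps_sum_def lookup_exps_of_set)

text \<open>Each edge keeps at least one of its two ends. Such covers witness tightness for three of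
  the four families: an end of the edge is removed for an edge inequality, the hub for a triangle
  and for the constant \<open>2 * n + 1\<close>.\<close>

lemma vertex_cover_remove_vertex:
  assumes "finite_simple_graph G"
  shows "vertex_cover G (vertices G - {v})"
proof -
  have "(vertices G - {v}) \<inter> e \<noteq> {}" if "e \<in> edges G" for e
  proof
    assume "(vertices G - {v}) \<inter> e = {}"
    then have "e \<subseteq> {v}" using assms that unfolding finite_simple_graph_def by blast
    then have "card e \<le> card {v}" by (intro card_mono) simp_all
    then show False using assms that unfolding finite_simple_graph_def by simp
  qed
  then show ?thesis unfolding vertex_cover_def by blast
qed

lemma card_odd_atMost: "card {i \<in> {1..2*n+1}. odd i} = n + 1"
proof (induction n)
  case 0
  have "{i \<in> {1..2*0+1}. odd i} = {1::nat}" by auto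
  then show ?case by simp
next
  case (Suc n)
  have "{i \<in> {1..2*Suc n+1}. odd i} = insert (2 * n + 3) {i \<in> {1..2*n+1}. odd i}"
    by (auto simp: le_Suc_eq)
  then show ?case using Suc by simp
qed

lemma helm_inequalities_tight:
  assumes n: "n \<ge> 1" and lc: "(l, c) \<in> helm_inequalities n"
  shows "\<exists>W. vertex_cover (helm_graph (2 * n + 1)) W \<and> l (exps_of_set W) = c"
proof -
  let ?G = "helm_graph (2 * n + 1)" and ?h = "2 * n + 2"
  have G: "finite_simple_graph ?G"
    using n by (intro finite_simple_graph_helm_graph) simp
  have V: "vertices ?G = {1..4 * n + 3}"
    unfolding vertices_helm_graph by simp
  have edge: "finite e" "card e = 2" "e \<subseteq> vertices ?G" if "e \<in> edges ?G" for e
    using G that unfolding finite_simple_graph_def by (auto intro: finite_subset)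
  have rem: "vertex_cover ?G (vertices ?G - {v})" for v
    by (rule vertex_cover_remove_vertex[OF G])
  have finV: "finite (vertices ?G)" unfolding V by simp
  from lc consider e where "e \<in> edges ?G" "l = exps_sum e" "c = 1"
    | e where "e \<in> cycle_edges (2 * n + 1)" "l = exps_sum (insert ?h e)" "c = 2"
    | "l = exps_sum {1..2 * n + 1}" "c = n + 1"
    | "l = (\<lambda>m. exps_sum {1..2 * n + 1} m + n * Poly_Mapping.lookup m ?h)" "c = 2 * n + 1"
    unfolding helm_inequalities_def by blast
  then show ?thesis
  proof cases
    case (1 e)
    then obtain v where "v \<in> e" using edge(2) by fastforce
    have "e \<inter> (vertices ?G - {v}) = e - {v}" using edge(3)[OF 1(1)] by blast
    then have "l (exps_of_set (vertices ?G - {v})) = c"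
      using 1 edge[OF 1(1)] \<open>v \<in> e\<close> finV by (simp add: exps_sum_exps_of_set)
    then show ?thesis using rem by blast
  next
    case (2 e)
    have e: "e \<in> edges ?G" using 2(1) unfolding edges_helm_graph by blast
    have "?h \<notin> e" using 2(1) unfolding cycle_edges_def by auto
    then have "insert ?h e \<inter> (vertices ?G - {?h}) = e" using edge(3)[OF e] by blast
    then have "l (exps_of_set (vertices ?G - {?h})) = c"
      using 2 edge[OF e] finV by (simp add: exps_sum_exps_of_set)
    then show ?thesis using rem by blast
  next
    case 3
    \<comment> \<open>On the cycle this cover misses exactly the even vertices, an independent set
      of the largest possible size \<open>n\<close>.\<close>
    let ?W = "{v \<in> vertices ?G. odd v \<or> ?h \<le> v}"
    have "vertex_cover ?G ?W"
      unfolding vertex_cover_helm_graph V by auto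
    moreover have "{1..2 * n + 1} \<inter> ?W = {i \<in> {1..2 * n + 1}. odd i}"
      unfolding V by auto
    then have "l (exps_of_set ?W) = c"
      using 3 finV card_odd_atMost[of n] by (simp add: exps_sum_exps_of_set)
    ultimately show ?thesis by blast
  next
    case 4
    have "{1..2 * n + 1} \<inter> (vertices ?G - {?h}) = {1..2 * n + 1}"
      unfolding V by auto
    then have "l (exps_of_set (vertices ?G - {?h})) = c"
      using 4 finV by (simp add: exps_sum_exps_of_set lookup_exps_of_set)
    then show ?thesis using rem by blast
  qed
qed

theorem theorem3p7:
  fixes n :: nat
    and S :: "(nat, 'k::field) mpoly ring"
    and J :: "(nat, 'k) mpoly set"
  assumes "n \<ge> 2"
    and "S = mpoly_ring {1..4 * n + 3}"
    and "J = cover_ideal (helm_graph (2 * n + 1))"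
  shows "normal_ideal S J \<and> strong_persistence_property S J \<and> persistence_property S J"
proof -
  let ?G = "helm_graph (2 * n + 1)"
  have n: "n \<ge> 1" using assms(1) by simp
  have V: "vertices ?G = {1..4 * n + 3}" unfolding vertices_helm_graph by simp
  have S: "S = mpoly_ring (vertices ?G)" unfolding V by (rule assms(2))
  have fin: "finite (vertices ?G)" unfolding V by simp
  have J: "J = monomial_span (cover_exps ?G)"
    unfolding assms(3) by (rule cover_ideal_eq_monomial_span[OF fin])
  have I: "ideal J (mpoly_ring (vertices ?G))"
    unfolding J by (rule ideal_monomial_span[OF exps_ideal_cover_exps])
  have pow: "ideal_pow (mpoly_ring (vertices ?G)) J t = monomial_span
      {m. Poly_Mapping.keys m \<subseteq> vertices ?G \<and> (\<forall>(l, c)\<in>helm_inequalities n. c * t \<le> l m)}" for t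
    unfolding J ideal_pow_monomial_span sumset_pow_helm_graph[OF n] ..
  have tight: "\<exists>a. Poly_Mapping.single a 1 \<in> J \<and> l a = c" if lc: "(l, c) \<in> helm_inequalities n" for l c
  proof -
    obtain W where W: "vertex_cover ?G W" "l (exps_of_set W) = c"
      using helm_inequalities_tight[OF n lc] by blast
    have W_sub: "W \<subseteq> vertices ?G" using W(1) unfolding vertex_cover_def by blast
    then have "exps_of_set W \<in> cover_exps ?G"
      using W(1) W_sub
      by (simp only: cover_exps_def keys_exps_of_set[OF finite_subset[OF W_sub fin]] mem_Collect_eq)
    then have "Poly_Mapping.single (exps_of_set W) 1 \<in> J"
      unfolding J by (rule single_in_monomial_span)
    then show ?thesis using W(2) by blast
  qed
  have normal: "normal_ideal S J"
    unfolding S by (rule normal_ideal_if_inequalities[OF I pow helm_inequalities_add])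
  have strong: "strong_persistence_property S J"
    unfolding S by (rule strong_persistence_property_if_inequalities[OF I pow helm_inequalities_add tight])
  interpret cring S unfolding S by (rule cring_mpoly_ring)
  \<comment> \<open>Persistence is derived from a finite generating set; the defining generators
    serve, as they are indexed by subsets of a finite vertex set.\<close>
  let ?A = "{(\<Prod>u\<in>W. mvar u) | W. minimal_vertex_cover ?G W} :: (nat, 'k) mpoly set"
  have J_gen: "J = Idl\<^bsub>S\<^esub> ?A" unfolding assms(3) cover_ideal_def S ..
  have sub: "{W. minimal_vertex_cover ?G W} \<subseteq> Pow (vertices ?G)"
    unfolding minimal_vertex_cover_def vertex_cover_def by blast
  have "?A = (\<lambda>W. \<Prod>u\<in>W. mvar u) ` {W. minimal_vertex_cover ?G W}" by blast
  then have "finite ?A"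
    using finite_subset[OF sub] fin by simp
  moreover have "?A \<subseteq> carrier S"
  proof
    fix p assume "p \<in> ?A"
    then obtain W where p: "p = Poly_Mapping.single (exps_of_set W) 1" and "minimal_vertex_cover ?G W"
      unfolding prod_mvar by blast
    then have W: "W \<subseteq> vertices ?G" using sub by blast
    show "p \<in> carrier S"
      unfolding S carrier_mpoly_ring p
      using W by (intro single_in_monomial_span) (simp only: mem_Collect_eq keys_exps_of_set[OF finite_subset[OF W fin]])
  qed
  ultimately have "persistence_property S J"
    using strong unfolding J_gen by (rule persistence_property_if_strong)
  then show ?thesis using normal strong by blast
qed

end
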